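(* Let $n\ge 1$ and let $T$ be a triangulated $(n+3)$-gon with diagonals labelled $1,\dots,n$ such that the quiver $Q=Q_T$ is acyclic with underlying graph the path $1 - 2 - \cdots - n$. Let $\overline{Q}=\overline{Q}_T$ be the associated ice quiver and $(\widetilde{Q},\widetilde{W})$ the associated quiver with potential. Then the maximal discrete subsets of $\overline{Q}$ are precisely the minimal cuts of $(\widetilde{Q},\widetilde{W})$; that is, a set of arrows of $\widetilde{Q}$ is a minimal cut of $(\widetilde{Q},\widetilde{W})$ if and only if it is contained in $\overline{Q}_1$ and is a maximal discrete subset of $\overline{Q}$.
   Context: Quivers from triangulations. Let $T$ be a triangulated (convex, planar) $(n+3)$-gon, with $n$ diagonals and $n+3$ boundary sides (boundary arcs). The quiver $Q_T$ has the diagonals as vertices and an arrow $i\to j$ whenever the diagonals $i,j$ are sides of a common triangle of $T$ and $j$ follows $i$ in the clockwise order on the boundary of that triangle. The ice quiver $\overline{Q}_T$ is obtained from $Q_T$ by adding a vertex for each boundary arc and adding, by the same rule, the arrows between diagonals and boundary arcs lying in a common triangle (no arrows between two boundary arcs). The frozen vertices are the boundary arcs. $\overline{Q}_1$ denotes the set of arrows; $s(\alpha),t(\alpha)$ are the source and target of an arrow. Discrete subsets. A set $D\subseteq\overline{Q}_1$ is discrete if for any $\alpha,\beta\in D$ there is no path in $Q$ (the full subquiver of $\overline{Q}$ on the non-frozen vertices) from $t(\alpha)$ to $s(\beta)$; paths of length $0$ at vertices of $Q$ count as paths. Maximal means maximal with respect to inclusion among discrete subsets. The quiver with potential $(\widetilde{Q},\widetilde{W})$.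 $\widetilde{Q}$ has the same vertices as $\overline{Q}$ and arrow set $\widetilde{Q}_1=\overline{Q}_1\sqcup I\sqcup E$, where: $I$ consists of an arrow $i\to j$ for boundary arcs $i,j$ lying in a common triangle of $T$ with $j$ following $i$ in clockwise order in this triangle, i.e. sharing the polygon vertex between them with $i\to j$ clockwise around the triangle at that vertex; $E$ (external arrows) consists of an arrow $i\to j$ for boundary arcs $i,j$ not in a common triangle of $T$ such that $i$ is the immediate predecessor of $j$ in the anticlockwise order of the boundary of the polygon. A triangle cycle is a cycle of length $3$ inside a triangle of $T$, made of arrows of $\overline{Q}_1\sqcup I$ (for a triangle with two boundary sides the cycle uses its arrow in $I$). A big cycle is a cycle winding around a vertex $v$ of the polygon and containing precisely one external arrow: for each vertex $v$ incident to at least one diagonal, it consists of the arrows of $\overline{Q}$ between consecutive arcs at $v$, together with the external arrow between the two boundary arcs at $v$. There are $n+1$ triangle cycles and $n+1$ big cycles. Put $\widetilde{W}=\sum(\text{triangle cycles})-\sum(\text{big cycles})$. Cuts. A cut of $(\widetilde{Q},\widetilde{W})$ is a subset $C\subseteq\widetilde{Q}_1$ such that every cyclic path appearing in $\widetilde{W}$ contains precisely one arrow in $C$. A cut $C$ is minimal if $|C|=n+1$. *)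

theory Defs
  imports Complex_Main "HOL-Library.Poly_Mapping"
begin

section \<open>Triangulated polygons\<close>

text \<open>
  The convex polygon with \<open>n + 3\<close> vertices has its vertices numbered \<open>0, \<dots>, n + 2\<close> in
  anticlockwise order.  An arc (a side or a diagonal) is the set of its two endpoints; whether
  two diagonals of a convex polygon cross in their interiors depends only on the cyclic order of
  their endpoints.
\<close>

type_synonym arc = "nat set"

definition next_vertex :: "nat \<Rightarrow> nat \<Rightarrow> nat" where
  "next_vertex n v = (v + 1) mod (n + 3)"

definition prev_vertex :: "nat \<Rightarrow> nat \<Rightarrow> nat" where
  "prev_vertex n v = (v + n + 2) mod (n + 3)"

definition boundary_arcs :: "nat \<Rightarrow> arc set" where
  "boundary_arcs n = {{v, next_vertex n v} | v. v < n + 3}"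

definition diagonals :: "nat \<Rightarrow> arc set" where
  "diagonals n = {{a, b} | a b. a < n + 3 \<and> b < n + 3 \<and> a \<noteq> b} - boundary_arcs n"

definition crossing :: "arc \<Rightarrow> arc \<Rightarrow> bool" where
  "crossing x y \<longleftrightarrow> (\<exists>a b c d. a < b \<and> b < c \<and> c < d \<and>
     ((x = {a, c} \<and> y = {b, d}) \<or> (x = {b, d} \<and> y = {a, c})))"

definition noncrossing :: "arc set \<Rightarrow> bool" where
  "noncrossing X \<longleftrightarrow> (\<forall>x\<in>X. \<forall>y\<in>X. \<not> crossing x y)"

text \<open>A triangulation is given by its set of diagonals.\<close>

definition triangulation :: "nat \<Rightarrow> arc set \<Rightarrow> bool" where
  "triangulation n T \<longleftrightarrow> T \<subseteq> diagonals n \<and> noncrossing T \<and>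
     (\<forall>x\<in>diagonals n. noncrossing (insert x T) \<longrightarrow> x \<in> T)"

definition arcs_of :: "nat \<Rightarrow> arc set \<Rightarrow> arc set" where
  "arcs_of n T = T \<union> boundary_arcs n"

fun sides :: "nat \<times> nat \<times> nat \<Rightarrow> arc set" where
  "sides (a, b, c) = {{a, b}, {b, c}, {a, c}}"

text \<open>
  Since the diagonals in \<open>T\<close> do not cross, three arcs of \<open>T\<close> forming a triangle always bound a
  triangle of the triangulation.
\<close>

definition triangles :: "nat \<Rightarrow> arc set \<Rightarrow> (nat \<times> nat \<times> nat) set" where
  "triangles n T = {(a, b, c) | a b c. a < b \<and> b < c \<and> sides (a, b, c) \<subseteq> arcs_of n T}"

section \<open>The quivers\<close>

text \<open>
  Two distinct arcs are sides of at most one common triangle, and an external arrow joins arcs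
  which are not in a common triangle.  So none of the quivers below has two arrows with the same
  source and target, and an arrow can be identified with the pair of its source and its target.
\<close>

type_synonym arrow = "arc \<times> arc"

abbreviation source :: "arrow \<Rightarrow> arc" where "source \<equiv> fst"
abbreviation target :: "arrow \<Rightarrow> arc" where "target \<equiv> snd"

text \<open>
  For \<open>a < b < c\<close> the anticlockwise order of the sides is \<open>ab, bc, ca\<close>, so the clockwise order is
  \<open>bc, ab, ca\<close>.  Cyclic paths are represented by the list of their arrows, in the order in which
  they are traversed and with a chosen starting point.
\<close>

fun triangle_cycle :: "nat \<times> nat \<times> nat \<Rightarrow> arrow list" where
  "triangle_cycle (a, b, c) =
     [({b, c}, {a, b}), ({a, b}, {a, c}), ({a, c}, {b, c})]"

definition clockwise_follows :: "nat \<Rightarrow> arc set \<Rightarrow> arc \<Rightarrow> arc \<Rightarrow> bool" where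
  "clockwise_follows n T i j \<longleftrightarrow> (\<exists>t\<in>triangles n T. (i, j) \<in> set (triangle_cycle t))"

definition Q_arrows :: "nat \<Rightarrow> arc set \<Rightarrow> arrow set" where
  "Q_arrows n T = {(i, j). i \<in> T \<and> j \<in> T \<and> clockwise_follows n T i j}"

definition ice_arrows :: "nat \<Rightarrow> arc set \<Rightarrow> arrow set" where
  "ice_arrows n T = Q_arrows n T \<union>
     {(i, j). (i \<in> T \<and> j \<in> boundary_arcs n \<or> i \<in> boundary_arcs n \<and> j \<in> T) \<and>
        clockwise_follows n T i j}"

definition I_arrows :: "nat \<Rightarrow> arc set \<Rightarrow> arrow set" where
  "I_arrows n T = {(i, j). i \<in> boundary_arcs n \<and> j \<in> boundary_arcs n \<and>
     clockwise_follows n T i j}"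

text \<open>
  This pair is an external arrow exactly when the two sides at \<open>v\<close> are not in a common triangle,
  that is, when \<open>v\<close> is incident to a diagonal (here \<open>n \<ge> 1\<close>).
\<close>

definition boundary_arrow :: "nat \<Rightarrow> nat \<Rightarrow> arrow" where
  "boundary_arrow n v = ({prev_vertex n v, v}, {v, next_vertex n v})"

definition E_arrows :: "nat \<Rightarrow> arc set \<Rightarrow> arrow set" where
  "E_arrows n T = {(i, j). (\<exists>v<n + 3. (i, j) = boundary_arrow n v) \<and>
     \<not> (\<exists>t\<in>triangles n T. i \<in> sides t \<and> j \<in> sides t)}"

definition tilde_arrows :: "nat \<Rightarrow> arc set \<Rightarrow> arrow set" where
  "tilde_arrows n T = ice_arrows n T \<union> I_arrows n T \<union> E_arrows n T"

section \<open>Discrete sets of arrows\<close>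

text \<open>The condition \<open>x \<in> T\<close> rules out paths of length 0 at frozen vertices.\<close>

definition path_in_Q :: "nat \<Rightarrow> arc set \<Rightarrow> arc \<Rightarrow> arc \<Rightarrow> bool" where
  "path_in_Q n T x y \<longleftrightarrow> x \<in> T \<and> y \<in> T \<and> (x, y) \<in> (Q_arrows n T)\<^sup>*"

definition discrete_set :: "nat \<Rightarrow> arc set \<Rightarrow> arrow set \<Rightarrow> bool" where
  "discrete_set n T D \<longleftrightarrow> D \<subseteq> ice_arrows n T \<and>
     (\<forall>\<alpha>\<in>D. \<forall>\<beta>\<in>D. \<not> path_in_Q n T (target \<alpha>) (source \<beta>))"

definition maximal_discrete_set :: "nat \<Rightarrow> arc set \<Rightarrow> arrow set \<Rightarrow> bool" where
  "maximal_discrete_set n T D \<longleftrightarrow> discrete_set n T D \<and>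
     (\<forall>D'. discrete_set n T D' \<longrightarrow> D \<subseteq> D' \<longrightarrow> D' = D)"

section \<open>The potential and its cuts\<close>

text \<open>
  The arcs at the polygon vertex \<open>v\<close>, from the side \<open>{v, v + 1}\<close> through the diagonals at \<open>v\<close> to
  the side \<open>{v, v - 1}\<close>.  In the triangle between two consecutive arcs of this list the second one
  follows the first one in the clockwise order.
\<close>

definition arcs_around :: "nat \<Rightarrow> arc set \<Rightarrow> nat \<Rightarrow> arc list" where
  "arcs_around n T v =
     filter (\<lambda>x. x \<in> arcs_of n T) (map (\<lambda>k. {v, (v + k) mod (n + 3)}) [1..<n + 3])"

definition big_cycle :: "nat \<Rightarrow> arc set \<Rightarrow> nat \<Rightarrow> arrow list" where
  "big_cycle n T v =
     (let xs = arcs_around n T v in zip xs (tl xs) @ [boundary_arrow n v])"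

text \<open>
  Potentials are linear combinations of cyclic paths; only the integral coefficients 1 and -1 are
  needed.  A cyclic path is only considered
  up to rotation; here every cycle of the potential enters with one fixed representative, and no
  triangle cycle is a rotation of a big cycle, as only the latter contain external arrows.
\<close>

definition potential :: "nat \<Rightarrow> arc set \<Rightarrow> arrow list \<Rightarrow>\<^sub>0 int" where
  "potential n T =
     (\<Sum>t\<in>triangles n T. frag_of (triangle_cycle t)) -
     (\<Sum>v\<in>{v. v < n + 3 \<and> (\<exists>x\<in>T. v \<in> x)}. frag_of (big_cycle n T v))"

definition cut :: "nat \<Rightarrow> arc set \<Rightarrow> arrow set \<Rightarrow> bool" where
  "cut n T C \<longleftrightarrow> C \<subseteq> tilde_arrows n T \<and>
     (\<forall>p\<in>Poly_Mapping.keys (potential n T). length (filter (\<lambda>\<alpha>. \<alpha> \<in> C) p) = 1)"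

definition minimal_cut :: "nat \<Rightarrow> arc set \<Rightarrow> arrow set \<Rightarrow> bool" where
  "minimal_cut n T C \<longleftrightarrow> cut n T C \<and> card C = n + 1"

end

theory Submission
  imports Defs
begin

text \<open>
  Every arrow of a triangle cycle is a corner of a triangle, from the arc \<open>{v, y}\<close> to the arc
  \<open>{v, z}\<close> where \<open>v, y, z\<close> are in anticlockwise order.  Both the maximal discrete sets and the minimal
  cuts are the sets of arrows crossing a threshold: for a set \<open>F\<close> of diagonals that is closed under
  successors in \<open>Q\<close>, take all arrows whose source is not in \<open>F\<close> and whose target is in \<open>F\<close> or frozen.
  As no triangle is internal, such a set has exactly one arrow in each of the \<open>n + 1\<close> triangles, so
  all these sets have the same size, and every discrete set is contained in one of them.

  Conversely, a minimal cut consists of one corner of each triangle, and its corners lie at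
  different polygon vertices.  For a diagonal \<open>{p, q}\<close>, the corners chosen at \<open>p\<close> and \<open>q\<close> lie on
  different sides of \<open>{p, q}\<close>; therefore the chosen corner precedes the diagonal at \<open>p\<close> if and
  only if it does so at \<open>q\<close>, and the diagonals with this property form the required set \<open>F\<close>.
\<close>

section \<open>Cyclic order and lists\<close>

text \<open>Strict anticlockwise order on the circle: from \<open>a\<close>, \<open>b\<close> is met
  before \<open>c\<close>. Its rotation invariance avoids case splits on the vertex
  numbering.\<close>

definition cyc :: "nat \<Rightarrow> nat \<Rightarrow> nat \<Rightarrow> bool" where
  "cyc a b c \<longleftrightarrow> a < b \<and> b < c \<or> b < c \<and> c < a \<or> c < a \<and> a < b"

lemma cyc_rotate: "cyc a b c \<longleftrightarrow> cyc b c a"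
  by (auto simp: cyc_def)

lemma cyc_distinct: "cyc a b c \<Longrightarrow> a \<noteq> b \<and> b \<noteq> c \<and> a \<noteq> c"
  by (auto simp: cyc_def)

lemma cyc_asym: "cyc a b c \<Longrightarrow> \<not> cyc a c b"
  by (auto simp: cyc_def)

lemma cyc_total: "a \<noteq> b \<Longrightarrow> b \<noteq> c \<Longrightarrow> a \<noteq> c \<Longrightarrow> cyc a b c \<or> cyc a c b"
  by (auto simp: cyc_def)

lemma cyc_trans: "cyc a b c \<Longrightarrow> cyc a c d \<Longrightarrow> cyc a b d"
  by (auto simp: cyc_def)

text \<open>Three points cut the circle into three open arcs.\<close>

lemma cyc_cover:
  assumes "cyc x y z" "v \<noteq> x" "v \<noteq> y" "v \<noteq> z"
  shows "cyc x v y \<or> cyc y v z \<or> cyc z v x"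
proof -
  have "cyc x y v \<Longrightarrow> cyc y z v \<Longrightarrow> cyc z v x"
    using assms(1) by (auto simp: cyc_def)
  then show ?thesis
    using cyc_total[of x v y] cyc_total[of y v z] assms cyc_distinct by metis
qed

text \<open>The linear order in \<open>crossing\<close> depends on where the circle is cut open; the
  separation of end points does not.\<close>

lemma crossing_iff_cyc:
  assumes "x \<noteq> y" "u \<noteq> w"
  shows "crossing {x, y} {u, w} \<longleftrightarrow> cyc x u y \<and> cyc y w x \<or> cyc x w y \<and> cyc y u x"
    (is "?l \<longleftrightarrow> ?r")
proof
  assume ?l
  then obtain a b c d where "a < b" "b < c" "c < d"
    and "{x, y} = {a, c} \<and> {u, w} = {b, d} \<or> {x, y} = {b, d} \<and> {u, w} = {a, c}"
    unfolding crossing_def by blast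
  then show ?r
    unfolding cyc_def doubleton_eq_iff by (elim disjE conjE) simp_all
next
  have *: "crossing {x, y} {u, w}"
    if "cyc x u y" "cyc y w x" "x \<noteq> y" "u \<noteq> w" for x y u w
  proof -
    \<comment> \<open>The four disjuncts are the possible places to cut open the cyclic order
      \<open>x\<close>, \<open>u\<close>, \<open>y\<close>, \<open>w\<close>.\<close>
    have "\<exists>a b c d. a < b \<and> b < c \<and> c < d \<and> (x = a \<and> y = c \<and> u = b \<and> w = d \<or>
        x = c \<and> y = a \<and> u = d \<and> w = b \<or> x = b \<and> y = d \<and> u = c \<and> w = a \<or>
        x = d \<and> y = b \<and> u = a \<and> w = c)"
      using that unfolding cyc_def by (elim disjE conjE) auto
    then obtain a b c d where "a < b" "b < c" "c < d"
      and "x = a \<and> y = c \<and> u = b \<and> w = d \<or>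
        x = c \<and> y = a \<and> u = d \<and> w = b \<or> x = b \<and> y = d \<and> u = c \<and> w = a \<or>
        x = d \<and> y = b \<and> u = a \<and> w = c"
      by blast
    then show ?thesis
      unfolding crossing_def by (intro exI[of _ a] exI[of _ b] exI[of _ c] exI[of _ d]) auto
  qed
  assume ?r
  with *[of x u y w] *[of x w y u] assms show ?l
    by (auto simp: insert_commute)
qed

section \<open>Sides of the polygon in terms of the cyclic order\<close>

lemma next_vertex_eq: "v < n + 3 \<Longrightarrow> next_vertex n v = (if v = n + 2 then 0 else v + 1)"
proof -
  assume "v < n + 3"
  then consider "v + 1 = n + 3" | "v + 1 < n + 3" by linarith
  then show ?thesis
    by cases (simp_all only: next_vertex_def mod_self mod_less, simp_all)
qed

lemma prev_vertex_eq: "v < n + 3 \<Longrightarrow> prev_vertex n v = (if v = 0 then n + 2 else v - 1)"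
proof -
  assume "v < n + 3"
  then show ?thesis
    using mod_add_self2[of "v - 1" "n + 3"]
    by (cases "v = 0") (simp_all add: prev_vertex_def del: mod_add_self2)
qed

lemma next_vertex_iff_gap:
  assumes "x < n + 3" "y < n + 3" "x \<noteq> y"
  shows "y = next_vertex n x \<longleftrightarrow> (\<forall>v < n + 3. \<not> cyc x v y)"
proof
  assume "y = next_vertex n x"
  then show "\<forall>v < n + 3. \<not> cyc x v y"
    using assms by (auto simp: next_vertex_eq cyc_def split: if_splits)
next
  assume gap: "\<forall>v < n + 3. \<not> cyc x v y"
  have "next_vertex n x < n + 3"
    using assms by (simp add: next_vertex_eq)
  \<comment> \<open>The successor of \<open>x\<close> would itself lie strictly between
    \<open>x\<close> and any other \<open>y\<close>.\<close>
  with gap have "\<not> cyc x (next_vertex n x) y"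
    by blast
  then show "y = next_vertex n x"
    using assms by (auto simp: next_vertex_eq cyc_def split: if_splits)
qed

lemma boundary_arcs_iff_gap:
  "{x, y} \<in> boundary_arcs n \<longleftrightarrow> x < n + 3 \<and> y < n + 3 \<and> x \<noteq> y \<and>
     ((\<forall>v < n + 3. \<not> cyc x v y) \<or> (\<forall>v < n + 3. \<not> cyc y v x))"
    (is "?l \<longleftrightarrow> ?r")
proof -
  have lt: "next_vertex n v < n + 3 \<and> next_vertex n v \<noteq> v" if "v < n + 3" for v
    using that by (auto simp: next_vertex_eq)
  have "?l \<longleftrightarrow> x < n + 3 \<and> y = next_vertex n x \<or> y < n + 3 \<and> x = next_vertex n y"
    unfolding boundary_arcs_def by (auto simp: doubleton_eq_iff)
  also have "\<dots> \<longleftrightarrow> ?r"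
    using lt next_vertex_iff_gap[of x n y] next_vertex_iff_gap[of y n x] by metis
  finally show ?thesis .
qed

section \<open>Consecutive entries of lists and counts along them\<close>

lemma set_zip_tl_sorted:
  fixes xs :: "nat list"
  assumes "sorted_wrt (<) xs"
  shows "(i, j) \<in> set (zip xs (tl xs)) \<longleftrightarrow>
    i \<in> set xs \<and> j \<in> set xs \<and> i < j \<and> (\<forall>l \<in> set xs. i < l \<longrightarrow> \<not> l < j)"
  using assms
proof (induction xs)
  case (Cons x xs)
  show ?case
  proof (cases xs)
    case (Cons y ys)
    have *: "(i, j) \<in> set (zip xs (tl xs)) \<longleftrightarrow>
      i \<in> set xs \<and> j \<in> set xs \<and> i < j \<and> (\<forall>l \<in> set xs. i < l \<longrightarrow> \<not> l < j)"
      using Cons.IH Cons.prems by simp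
    have lt: "\<forall>l \<in> set xs. x < l" "\<forall>l \<in> set ys. y < l" and "y \<in> set xs"
      using Cons.prems Cons by auto
    have "(i, j) \<in> set (zip (x # xs) (tl (x # xs))) \<longleftrightarrow> i = x \<and> j = y \<or> (i, j) \<in> set (zip xs (tl xs))"
      using Cons by simp
    \<comment> \<open>A consecutive pair that starts at the head \<open>x\<close> ends at the
      minimum \<open>y\<close> of the tail.\<close>
    moreover have "j = y \<longleftrightarrow> j \<in> set xs \<and> (\<forall>l \<in> set xs. \<not> l < j)"
      using lt(2) Cons by (auto simp: not_less)
    ultimately show ?thesis
      unfolding * using lt(1) by auto
  qed simp
qed simp

lemma length_filter_eq_1_iff:
  assumes "distinct xs"
  shows "length (filter P xs) = 1 \<longleftrightarrow> (\<exists>!x. x \<in> set xs \<and> P x)"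
proof -
  have "length (filter P xs) = card {x. x \<in> set xs \<and> P x}"
    using distinct_card[of "filter P xs"] assms by simp
  then show ?thesis
    by (simp add: card_1_singleton_iff set_eq_iff Ex1_def) metis
qed

text \<open>Injectivity makes every coefficient of either sum 0 or 1, and disjointness of the images
  prevents cancellation.\<close>

lemma keys_frag_sum_diff:
  assumes "finite A" "finite B" "inj_on f A" "inj_on g B" "f ` A \<inter> g ` B = {}"
  shows "Poly_Mapping.keys ((\<Sum>a\<in>A. frag_of (f a)) - (\<Sum>b\<in>B. frag_of (g b))) = f ` A \<union> g ` B"
proof -
  have lookup: "Poly_Mapping.lookup (\<Sum>a\<in>A. frag_of (f a)) x = (if x \<in> f ` A then 1 else 0)"
    if "finite A" "inj_on f A" for A :: "'x set" and f :: "'x \<Rightarrow> 'y" and x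
  proof -
    have "Poly_Mapping.lookup (\<Sum>a\<in>A. frag_of (f a)) x = (\<Sum>a\<in>A. Poly_Mapping.lookup (frag_of (f a)) x)"
      by (simp add: lookup_sum)
    also have "\<dots> = (\<Sum>y\<in>f ` A. if y = x then 1 else 0)"
      unfolding sum.reindex[OF that(2)] by (intro sum.cong) auto
    also have "\<dots> = (if x \<in> f ` A then 1 else 0)"
      using that(1) by (simp add: sum.delta)
    finally show ?thesis .
  qed
  show ?thesis
    using assms(5)
    by (auto simp: in_keys_iff lookup_minus lookup[OF assms(1,3)] lookup[OF assms(2,4)] split: if_splits)
qed

text \<open>A path of diagonals that ends at a frozen vertex cannot leave \<open>F\<close> before
  its end. Starting outside \<open>F\<close>, it crosses the threshold once: on entering
  \<open>F\<close>, or at the last arrow if it never does.\<close>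

lemma length_filter_threshold:
  assumes "set ds \<subseteq> T" "b' \<notin> T"
    and "\<And>i j. (i, j) \<in> set (zip (x # ds @ [b']) (ds @ [b'])) \<Longrightarrow> i \<in> F \<Longrightarrow> j \<in> T \<Longrightarrow> j \<in> F"
  shows "length (filter (\<lambda>(i, j). i \<notin> F \<and> j \<notin> T - F) (zip (x # ds @ [b']) (ds @ [b']))) =
    (if x \<in> F then 0 else 1)"
  using assms
proof (induction ds arbitrary: x)
  case (Cons y ds)
  have "length (filter (\<lambda>(i, j). i \<notin> F \<and> j \<notin> T - F) (zip (y # ds @ [b']) (ds @ [b']))) =
    (if y \<in> F then 0 else 1)"
    using Cons.prems by (intro Cons.IH) auto
  moreover have "x \<in> F \<Longrightarrow> y \<in> F" "y \<in> T"
    using Cons.prems by auto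
  ultimately show ?case
    by auto
qed auto

text \<open>Propositional core of the count in one triangle with sides \<open>a\<close>,
  \<open>b\<close>, \<open>c\<close> in arrow order: \<open>t\<close> stands for being a diagonal
  and \<open>f\<close> for membership in \<open>F\<close>.\<close>

lemma exactly_one_threshold:
  assumes "fa \<and> tb \<longrightarrow> fb" "fb \<and> tc \<longrightarrow> fc" "fc \<and> ta \<longrightarrow> fa"
    and "fa \<longrightarrow> ta" "fb \<longrightarrow> tb" "fc \<longrightarrow> tc" "\<not> (ta \<and> tb \<and> tc)" "ta \<or> tb \<or> tc"
  shows "of_bool ((ta \<or> tb) \<and> \<not> fa \<and> \<not> (tb \<and> \<not> fb)) + of_bool ((tc \<or> ta) \<and> \<not> fc \<and> \<not> (ta \<and> \<not> fa)) +
    of_bool ((tb \<or> tc) \<and> \<not> fb \<and> \<not> (tc \<and> \<not> fc)) = (1 :: nat)"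
  using assms by (cases ta; cases tb; cases tc; cases fa; cases fb; cases fc; simp)

section \<open>Triangulated polygons\<close>

locale triangulated_polygon =
  fixes n :: nat and T :: "arc set"
  assumes triangulation: "triangulation n T"
begin

abbreviation is_arc :: "nat \<Rightarrow> nat \<Rightarrow> bool" where
  "is_arc x y \<equiv> {x, y} \<in> arcs_of n T"

text \<open>For distinct polygon vertices this is an oriented side of the polygon; the orientation
  records on which side of the arc there is no triangle.\<close>

definition gap :: "nat \<Rightarrow> nat \<Rightarrow> bool" where
  "gap x y \<longleftrightarrow> (\<forall>v < n + 3. \<not> cyc x v y)"

text \<open>The triple stands for the corner at \<open>v\<close>, that is, for the arrow from
  \<open>{v, y}\<close> to \<open>{v, z}\<close>; the rotations give the three corners of one
  triangle.\<close>

definition tri :: "nat \<Rightarrow> nat \<Rightarrow> nat \<Rightarrow> bool" where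
  "tri v y z \<longleftrightarrow> cyc v y z \<and> is_arc v y \<and> is_arc v z \<and> is_arc y z"

lemma is_arc_commute: "is_arc x y \<longleftrightarrow> is_arc y x"
  by (simp add: insert_commute)

lemma tri_rotate: "tri v y z \<longleftrightarrow> tri y z v"
  unfolding tri_def by (auto simp: insert_commute cyc_rotate[of v])

lemma boundary_iff: "{x, y} \<in> boundary_arcs n \<longleftrightarrow>
    x < n + 3 \<and> y < n + 3 \<and> x \<noteq> y \<and> (gap x y \<or> gap y x)"
  unfolding gap_def by (rule boundary_arcs_iff_gap)

lemma diagonal_bounds:
  assumes "{x, y} \<in> T" shows "x < n + 3" "y < n + 3" "x \<noteq> y"
proof -
  have "{x, y} \<in> diagonals n"
    using assms triangulation by (auto simp: triangulation_def)
  then show "x < n + 3" "y < n + 3" "x \<noteq> y"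
    by (auto simp: diagonals_def doubleton_eq_iff)
qed

lemma diagonal_not_boundary: "e \<in> T \<Longrightarrow> e \<notin> boundary_arcs n"
  using triangulation by (auto simp: triangulation_def diagonals_def)

lemma diagonal_not_gap: "{x, y} \<in> T \<Longrightarrow> \<not> gap x y \<and> \<not> gap y x"
  using diagonal_not_boundary[of "{x, y}"] diagonal_bounds[of x y] boundary_iff by blast

lemma is_arc_bounds:
  assumes "is_arc x y" shows "x < n + 3" "y < n + 3" "x \<noteq> y"
  using assms diagonal_bounds[of x y] boundary_iff[of x y] by (auto simp: arcs_of_def)

lemma arc_cases:
  assumes "is_arc x y" obtains "{x, y} \<in> T" | "gap x y" | "gap y x"
  using assms boundary_iff[of x y] by (auto simp: arcs_of_def)

lemma gap_is_arc: "gap x y \<Longrightarrow> x < n + 3 \<Longrightarrow> y < n + 3 \<Longrightarrow> x \<noteq> y \<Longrightarrow> is_arc x y"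
  by (simp add: arcs_of_def boundary_iff)

lemma T_is_arc: "{x, y} \<in> T \<Longrightarrow> is_arc x y"
  by (simp add: arcs_of_def)

text \<open>For two diagonals this is part of being a triangulation. A side of the polygon is
  crossed by nothing, as no vertex lies in its gap.\<close>

lemma noncrossing_arcs:
  assumes "is_arc a c" "is_arc b d" "cyc a b c" shows "\<not> cyc c d a"
proof
  assume "cyc c d a"
  have neq: "a \<noteq> c" "b \<noteq> d" and lt: "a < n + 3" "b < n + 3" "c < n + 3" "d < n + 3"
    using is_arc_bounds[OF assms(1)] is_arc_bounds[OF assms(2)] by auto
  have "\<not> crossing {a, c} {b, d}"
  proof (cases "{a, c} \<in> T \<and> {b, d} \<in> T")
    case True
    then show ?thesis
      using triangulation by (auto simp: triangulation_def noncrossing_def)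
  next
    case False
    then have "gap a c \<or> gap c a \<or> gap b d \<or> gap d b"
      using assms(1,2) by (auto simp: arcs_of_def boundary_iff)
    moreover have "cyc b c d" "cyc d a b"
      using assms(3) \<open>cyc c d a\<close> by (auto simp: cyc_def)
    ultimately show ?thesis
      using assms(3) \<open>cyc c d a\<close> lt by (auto simp: gap_def)
  qed
  then show False
    using crossing_iff_cyc[OF neq] assms(3) \<open>cyc c d a\<close> by blast
qed

text \<open>The apex is the last vertex before \<open>y\<close> that is joined to \<open>x\<close>.\<close>

lemma apex:
  assumes xy: "is_arc x y" "\<not> gap x y"
  obtains z where "tri x z y"
proof -
  note lt = is_arc_bounds[OF xy(1)]
  define Z where "Z = {z. z < n + 3 \<and> cyc x z y \<and> is_arc x z}"
  define after where "after = (\<lambda>z. {v. v < n + 3 \<and> cyc z v y})"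
  \<comment> \<open>The side leaving \<open>x\<close> shows that there is a candidate for the
    apex.\<close>
  have "next_vertex n x \<in> Z"
  proof -
    let ?s = "next_vertex n x"
    have s: "?s < n + 3" "?s \<noteq> x"
      using lt by (simp_all add: next_vertex_eq)
    then have "gap x ?s"
      using next_vertex_iff_gap[of x n ?s] lt unfolding gap_def by auto
    moreover have "?s \<noteq> y"
      using \<open>gap x ?s\<close> xy(2) by auto
    moreover obtain v where "v < n + 3" "cyc x v y"
      using xy(2) unfolding gap_def by blast
    ultimately have "cyc x ?s y"
      using s lt cyc_total[of x ?s y] cyc_trans[of x v y ?s] unfolding gap_def by metis
    then show ?thesis
      unfolding Z_def using s lt gap_is_arc[OF \<open>gap x ?s\<close>] by auto
  qed
  \<comment> \<open>On a circle, being last before \<open>y\<close> is expressed by having the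
    fewest vertices between \<open>z\<close> and \<open>y\<close>.\<close>
  then obtain z where z: "z \<in> Z" and min: "\<And>u. u \<in> Z \<Longrightarrow> card (after z) \<le> card (after u)"
    using arg_min_nat_lemma[of "\<lambda>z. z \<in> Z" _ "\<lambda>z. card (after z)"] by blast
  have zlt: "z < n + 3" and zc: "cyc x z y" and za: "is_arc x z"
    using z by (auto simp: Z_def)
  have max: "\<not> is_arc x u" if "cyc z u y" for u
  proof
    assume u: "is_arc x u"
    have "cyc x u y"
      using that zc by (auto simp: cyc_def)
    with u is_arc_bounds[OF u] have "u \<in> Z"
      by (auto simp: Z_def)
    moreover have "after u \<subset> after z"
    proof (rule psubsetI)
      have "cyc z v y" if "cyc u v y" for v
        using that \<open>cyc z u y\<close> by (auto simp: cyc_def)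
      then show "after u \<subseteq> after z"
        by (auto simp: after_def)
      have "u \<in> after z" "u \<notin> after u"
        using that is_arc_bounds[OF u] by (simp_all add: after_def cyc_def)
      then show "after u \<noteq> after z"
        by blast
    qed
    then have "card (after u) < card (after z)"
      by (intro psubset_card_mono) (auto simp: after_def)
    ultimately show False
      using min[of u] by simp
  qed
  have "is_arc z y"
  proof (cases "{z, y} \<in> boundary_arcs n")
    case False
    have zy: "z \<noteq> y"
      using zc by (auto simp: cyc_def)
    with False have diag: "{z, y} \<in> diagonals n"
      unfolding diagonals_def using zlt lt by blast
    \<comment> \<open>A crossing diagonal has an end \<open>u\<close> between \<open>z\<close> and
      \<open>y\<close>. Its other end is \<open>x\<close>, against the choice of \<open>z\<close>,
      or lies beyond \<open>{x, z}\<close> or \<open>{x, y}\<close> and forces a crossing with that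
      arc. Maximality of \<open>T\<close> then yields the arc \<open>{z, y}\<close>.\<close>
    have ok: "\<not> crossing {z, y} e" if "e \<in> T" for e
    proof
      assume cr: "crossing {z, y} e"
      have "e \<in> diagonals n"
        using that triangulation by (auto simp: triangulation_def)
      then obtain u' w' where "e = {u', w'}" "u' \<noteq> w'"
        by (auto simp: diagonals_def)
      with cr zy obtain u w where e: "e = {u, w}" and u: "cyc z u y" and w: "cyc y w z"
        using crossing_iff_cyc[of z y u' w'] by (metis insert_commute)
      have uw: "is_arc u w"
        using that e by (simp add: arcs_of_def)
      have "w \<noteq> x"
        using max[OF u] uw is_arc_commute by blast
      then have "cyc x w z \<or> cyc y w x"
        using w zc by (auto simp: cyc_def)
      then show False
      proof
        assume "cyc x w z"
        moreover have "cyc z u x"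
          using u zc by (auto simp: cyc_def)
        ultimately show False
          using noncrossing_arcs[of x z w u] za uw is_arc_commute by blast
      next
        assume "cyc y w x"
        moreover have "cyc x u y"
          using u zc by (auto simp: cyc_def)
        ultimately show False
          using noncrossing_arcs[of x y u w] xy uw by blast
      qed
    qed
    then have "\<not> crossing e {z, y}" if "e \<in> T" for e
      using that unfolding crossing_def by blast
    moreover have "\<not> crossing {z, y} {z, y}"
      using crossing_iff_cyc[of z y z y] zy by (auto simp: cyc_def)
    ultimately have "noncrossing (insert {z, y} T)"
      using ok triangulation by (auto simp: noncrossing_def triangulation_def)
    then show ?thesis
      using diag triangulation by (auto simp: triangulation_def arcs_of_def)
  qed (simp add: arcs_of_def)
  then have "tri x z y"
    unfolding tri_def using zc za xy by blast
  then show ?thesis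
    by (rule that)
qed

text \<open>An arc inside the corner at \<open>v\<close> would cross the opposite side
  \<open>{y, z}\<close>.\<close>

lemma tri_consecutive:
  assumes "tri v y z" "is_arc v w" "cyc v y w" shows "\<not> cyc v w z"
proof
  assume "cyc v w z"
  then have "cyc y w z" "cyc z v y"
    using assms by (auto simp: tri_def cyc_def)
  then show False
    using noncrossing_arcs[of y z w v] assms by (auto simp: tri_def insert_commute)
qed

text \<open>The apex \<open>w\<close> of the triangle at \<open>{v, z}\<close> must be
  \<open>y\<close>: a later \<open>w\<close> would separate \<open>y\<close> from \<open>z\<close>,
  and for an earlier one the arc \<open>{v, y}\<close> would run inside the corner.\<close>

lemma consecutive_tri:
  assumes "is_arc v y" "is_arc v z" "cyc v y z"
    and "\<And>w. is_arc v w \<Longrightarrow> cyc v y w \<Longrightarrow> \<not> cyc v w z"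
  shows "tri v y z"
proof -
  have "\<not> gap v z"
    using assms is_arc_bounds unfolding gap_def by blast
  then obtain w where w: "tri v w z"
    using apex assms by blast
  have "w = y"
  proof (rule ccontr)
    assume "w \<noteq> y"
    then have "cyc v w y"
      using assms(1,3) assms(4)[of w] w cyc_total[of v w y] is_arc_bounds
      by (metis cyc_distinct tri_def)
    then show False
      using tri_consecutive[OF w assms(1)] assms(3) by blast
  qed
  with w show ?thesis by simp
qed

section \<open>Arrows as corners of triangles\<close>

lemma clockwise_follows_iff:
  "clockwise_follows n T i j \<longleftrightarrow> (\<exists>v y z. tri v y z \<and> i = {v, y} \<and> j = {v, z})"
proof
  assume "clockwise_follows n T i j"
  then obtain a b c where "(a, b, c) \<in> triangles n T" and *: "(i, j) \<in> set (triangle_cycle (a, b, c))"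
    unfolding clockwise_follows_def by auto
  then have "tri a b c"
    by (auto simp: triangles_def tri_def cyc_def)
  then have "tri a b c" "tri b c a" "tri c a b"
    using tri_rotate by blast+
  moreover have "i = {b, c} \<and> j = {b, a} \<or> i = {a, b} \<and> j = {a, c} \<or> i = {c, a} \<and> j = {c, b}"
    using * by (auto simp: insert_commute)
  ultimately show "\<exists>v y z. tri v y z \<and> i = {v, y} \<and> j = {v, z}"
    by blast
next
  assume "\<exists>v y z. tri v y z \<and> i = {v, y} \<and> j = {v, z}"
  then obtain v y z where t: "tri v y z" and ij: "i = {v, y}" "j = {v, z}"
    by blast
  \<comment> \<open>Exactly one rotation of the triple is increasing, as \<open>triangles\<close>
    demands.\<close>
  from t consider "v < y" "y < z" | "y < z" "z < v" | "z < v" "v < y"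
    by (auto simp: tri_def cyc_def)
  then show "clockwise_follows n T i j"
  proof cases
    case 1
    then have "(v, y, z) \<in> triangles n T" using t by (auto simp: triangles_def tri_def)
    then show ?thesis
      unfolding clockwise_follows_def ij by (rule bexI[rotated]) simp
  next
    case 2
    then have "(y, z, v) \<in> triangles n T"
      using t by (auto simp: triangles_def tri_def insert_commute)
    then show ?thesis
      unfolding clockwise_follows_def ij by (rule bexI[rotated]) (simp add: insert_commute)
  next
    case 3
    then have "(z, v, y) \<in> triangles n T"
      using t by (auto simp: triangles_def tri_def insert_commute)
    then show ?thesis
      unfolding clockwise_follows_def ij by (rule bexI[rotated]) (simp add: insert_commute)
  qed
qed

lemma tri_unique: "tri v y z \<Longrightarrow> tri v y z' \<Longrightarrow> z = z'"
  using tri_consecutive[of v y z z'] tri_consecutive[of v y z' z] cyc_total[of v z z']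
  unfolding tri_def by (metis cyc_distinct)

lemma tri_unique': "tri v y z \<Longrightarrow> tri v y' z \<Longrightarrow> y = y'"
  using tri_unique tri_rotate by blast

lemma Q_arrows_iff: "(i, j) \<in> Q_arrows n T \<longleftrightarrow> clockwise_follows n T i j \<and> i \<in> T \<and> j \<in> T"
  by (auto simp: Q_arrows_def)

lemma clockwise_follows_arcs:
  "clockwise_follows n T i j \<Longrightarrow> i \<in> T \<union> boundary_arcs n \<and> j \<in> T \<union> boundary_arcs n"
  unfolding clockwise_follows_iff tri_def arcs_of_def by blast

lemma ice_arrows_iff:
  "(i, j) \<in> ice_arrows n T \<longleftrightarrow> clockwise_follows n T i j \<and> (i \<in> T \<or> j \<in> T)"
  using clockwise_follows_arcs[of i j] by (auto simp: ice_arrows_def Q_arrows_def)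

text \<open>Around \<open>v\<close>, a corner arrow leads to an arc further anticlockwise, while the
  boundary arrow leads from the last arc back to the first.\<close>

lemma boundary_arrow_not_clockwise:
  assumes "v < n + 3" "boundary_arrow n v = (i, j)"
  shows "\<not> clockwise_follows n T i j"
proof
  assume "clockwise_follows n T i j"
  then obtain u y z where t: "tri u y z" and ij: "i = {u, y}" "j = {u, z}"
    by (auto simp: clockwise_follows_iff)
  let ?p = "prev_vertex n v" and ?s = "next_vertex n v"
  have ps: "?p \<noteq> v" "?s \<noteq> v" "?p \<noteq> ?s" "cyc ?p v ?s"
    using assms(1) by (auto simp: next_vertex_eq prev_vertex_eq cyc_def)
  have "{?p, v} = {u, y}" "{v, ?s} = {u, z}"
    using assms(2) ij by (auto simp: boundary_arrow_def)
  then have "u = v" "y = ?p" "z = ?s"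
    using ps t by (auto simp: doubleton_eq_iff tri_def cyc_def)
  then show False
    using ps(4) t by (auto simp: tri_def cyc_def)
qed

section \<open>The cycles of the potential and the number of triangles\<close>

lemma finite_triangles: "finite (triangles n T)"
proof (rule finite_subset)
  show "triangles n T \<subseteq> {..<n + 3} \<times> {..<n + 3} \<times> {..<n + 3}"
    using is_arc_bounds by (fastforce simp: triangles_def)
qed simp

lemma triangles_iff: "(a, b, c) \<in> triangles n T \<longleftrightarrow> tri a b c \<and> a < b \<and> b < c"
  by (auto simp: triangles_def tri_def cyc_def)

lemma tri_triangles:
  assumes "tri x y z"
  shows "(x, y, z) \<in> triangles n T \<or> (y, z, x) \<in> triangles n T \<or> (z, x, y) \<in> triangles n T"
proof -
  have "tri y z x" "tri z x y"
    using assms tri_rotate by blast+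
  then show ?thesis
    using assms unfolding triangles_iff tri_def cyc_def by blast
qed

lemma triangle_cycle_vertices:
  "(i, j) \<in> set (triangle_cycle (a, b, c)) \<Longrightarrow> i \<union> j = {a, b, c}"
  by auto

lemma distinct_triangle_cycle: "(a, b, c) \<in> triangles n T \<Longrightarrow> distinct (triangle_cycle (a, b, c))"
  by (auto simp: triangles_iff doubleton_eq_iff)

lemma triangle_cycle_disjoint:
  assumes "t \<in> triangles n T" "t' \<in> triangles n T"
    and "\<alpha> \<in> set (triangle_cycle t)" "\<alpha> \<in> set (triangle_cycle t')"
  shows "t = t'"
proof -
  obtain a b c a' b' c' where t: "t = (a, b, c)" "t' = (a', b', c')"
    by (metis prod.exhaust)
  obtain i j where "\<alpha> = (i, j)"
    by fastforce
  then have "{a, b, c} = {a', b', c'}"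
    using triangle_cycle_vertices assms t by metis
  moreover have "a < b" "b < c" "a' < b'" "b' < c'"
    using assms(1,2) t by (auto simp: triangles_iff)
  \<comment> \<open>The two ends of an arrow contain all three vertices of its triangle; sorting
    them recovers the triple.\<close>
  moreover have "sorted_list_of_set {a, b, c} = [a, b, c]" if "a < b" "b < c" for a b c :: nat
    using that by simp
  ultimately have "[a, b, c] = [a', b', c']"
    by metis
  then show ?thesis
    using t by simp
qed

lemma big_cycle_eq: "big_cycle n T v = zip (arcs_around n T v) (tl (arcs_around n T v)) @ [boundary_arrow n v]"
  by (simp add: big_cycle_def Let_def)

lemma boundary_arrow_inj:
  assumes "v < n + 3" "v' < n + 3" "boundary_arrow n v = boundary_arrow n v'"
  shows "v = v'"
proof -
  have "prev_vertex n v \<noteq> v" "next_vertex n v \<noteq> v" "prev_vertex n v \<noteq> next_vertex n v"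
    using assms(1) by (auto simp: next_vertex_eq prev_vertex_eq)
  moreover have "prev_vertex n v' \<noteq> v'" "next_vertex n v' \<noteq> v'" "prev_vertex n v' \<noteq> next_vertex n v'"
    using assms(2) by (auto simp: next_vertex_eq prev_vertex_eq)
  ultimately show ?thesis
    using assms(3) by (auto simp: boundary_arrow_def doubleton_eq_iff)
qed

text \<open>No two cycles of the potential coincide or cancel: a triangle cycle is determined by any
  of its arrows, a big cycle by its last arrow, and that last arrow lies in no triangle
  cycle.\<close>

lemma cut_iff:
  "cut n T C \<longleftrightarrow> C \<subseteq> tilde_arrows n T \<and>
    (\<forall>t \<in> triangles n T. length (filter (\<lambda>\<alpha>. \<alpha> \<in> C) (triangle_cycle t)) = 1) \<and>
    (\<forall>v \<in> \<Union>T. length (filter (\<lambda>\<alpha>. \<alpha> \<in> C) (big_cycle n T v)) = 1)"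
proof -
  have lt: "v < n + 3" if "v \<in> \<Union>T" for v
    using that triangulation by (auto simp: triangulation_def diagonals_def)
  then have V: "{v. v < n + 3 \<and> (\<exists>x\<in>T. v \<in> x)} = \<Union>T"
    by auto
  have fin: "finite (\<Union>T)"
    using V by (metis finite_Collect_conjI finite_Collect_less_nat)
  have injt: "inj_on triangle_cycle (triangles n T)"
  proof (rule inj_onI)
    fix t t' assume t: "t \<in> triangles n T" "t' \<in> triangles n T" "triangle_cycle t = triangle_cycle t'"
    obtain a b c where "t = (a, b, c)"
      by (metis prod.exhaust)
    then have "hd (triangle_cycle t) \<in> set (triangle_cycle t)"
      by simp
    with t show "t = t'"
      by (metis triangle_cycle_disjoint)
  qed
  have injb: "inj_on (big_cycle n T) (\<Union>T)"
  proof (rule inj_onI)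
    fix v v' assume v: "v \<in> \<Union>T" "v' \<in> \<Union>T" and eq: "big_cycle n T v = big_cycle n T v'"
    have "boundary_arrow n v = last (big_cycle n T v)" for v
      by (simp add: big_cycle_eq)
    then have "boundary_arrow n v = boundary_arrow n v'"
      using eq by metis
    with lt v show "v = v'"
      using boundary_arrow_inj by blast
  qed
  have disj: "triangle_cycle ` triangles n T \<inter> big_cycle n T ` \<Union>T = {}"
  proof (intro equals0I)
    fix p assume "p \<in> triangle_cycle ` triangles n T \<inter> big_cycle n T ` \<Union>T"
    then obtain t v where t: "t \<in> triangles n T" and v: "v \<in> \<Union>T"
      and eq: "triangle_cycle t = big_cycle n T v"
      by (elim IntE imageE) simp
    have "boundary_arrow n v \<in> set (triangle_cycle t)"
      unfolding eq by (simp add: big_cycle_eq)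
    then show False
      using boundary_arrow_not_clockwise[OF lt[OF v]] t
      unfolding clockwise_follows_def by (metis surj_pair)
  qed
  have "Poly_Mapping.keys (potential n T) = triangle_cycle ` triangles n T \<union> big_cycle n T ` \<Union>T"
    unfolding potential_def V by (rule keys_frag_sum_diff[OF finite_triangles fin injt injb disj])
  then show ?thesis
    by (simp add: cut_def ball_Un)
qed

text \<open>The count is the same for all rotations of a triple, which removes the increasing order
  from the condition. The summands belong to the corners at \<open>x\<close>, \<open>y\<close>,
  \<open>z\<close>.\<close>

lemma triangle_cycle_count_iff:
  "(\<forall>t \<in> triangles n T. length (filter (\<lambda>\<alpha>. \<alpha> \<in> C) (triangle_cycle t)) = 1) \<longleftrightarrow>
   (\<forall>x y z. tri x y z \<longrightarrow> of_bool (({x, y}, {x, z}) \<in> C) + of_bool (({y, z}, {y, x}) \<in> C) +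
      of_bool (({z, x}, {z, y}) \<in> C) = (1 :: nat))"
    (is "?l \<longleftrightarrow> ?r")
proof -
  have count: "length (filter (\<lambda>\<alpha>. \<alpha> \<in> C) (triangle_cycle (x, y, z))) =
    of_bool (({x, y}, {x, z}) \<in> C) + of_bool (({y, z}, {y, x}) \<in> C) + of_bool (({z, x}, {z, y}) \<in> C)"
    for x y z
    by (simp add: insert_commute)
  show ?thesis
  proof
    assume l: ?l
    show ?r
    proof (intro allI impI)
      fix x y z assume "tri x y z"
      from tri_triangles[OF this] show "of_bool (({x, y}, {x, z}) \<in> C) + of_bool (({y, z}, {y, x}) \<in> C) +
        of_bool (({z, x}, {z, y}) \<in> C) = (1 :: nat)"
      proof (elim disjE)
        assume "(x, y, z) \<in> triangles n T"
        from bspec[OF l this] count[of x y z] show ?thesis by linarith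
      next
        assume "(y, z, x) \<in> triangles n T"
        from bspec[OF l this] count[of y z x] show ?thesis by linarith
      next
        assume "(z, x, y) \<in> triangles n T"
        from bspec[OF l this] count[of z x y] show ?thesis by linarith
      qed
    qed
  next
    assume ?r
    show ?l
    proof
      fix t assume t: "t \<in> triangles n T"
      obtain x y z where xyz: "t = (x, y, z)"
        by (metis prod.exhaust)
      with t have "tri x y z"
        by (simp add: triangles_iff)
      with \<open>?r\<close> show "length (filter (\<lambda>\<alpha>. \<alpha> \<in> C) (triangle_cycle t)) = 1"
        unfolding xyz count by blast
    qed
  qed
qed

text \<open>The triangle cycles are disjoint and cover \<open>C\<close>, so \<open>C\<close> is a
  disjoint union of singletons, one for each triangle.\<close>

lemma card_transversal:
  assumes sub: "\<And>i j. (i, j) \<in> C \<Longrightarrow> clockwise_follows n T i j"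
    and one: "\<forall>t \<in> triangles n T. length (filter (\<lambda>\<alpha>. \<alpha> \<in> C) (triangle_cycle t)) = 1"
  shows "card C = card (triangles n T)" "finite C"
proof -
  have C: "C = (\<Union>t \<in> triangles n T. {\<alpha> \<in> set (triangle_cycle t). \<alpha> \<in> C})"
    using sub unfolding clockwise_follows_def by fast
  have "finite (\<Union>t \<in> triangles n T. {\<alpha> \<in> set (triangle_cycle t). \<alpha> \<in> C})"
    by (rule finite_UN_I[OF finite_triangles]) simp
  with C show "finite C"
    by (rule ssubst)
  have "card C = (\<Sum>t \<in> triangles n T. card {\<alpha> \<in> set (triangle_cycle t). \<alpha> \<in> C})"
  proof (subst C, rule card_UN_disjoint[OF finite_triangles])
    show "\<forall>t \<in> triangles n T. finite {\<alpha> \<in> set (triangle_cycle t). \<alpha> \<in> C}"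
      by simp
    show "\<forall>t \<in> triangles n T. \<forall>t' \<in> triangles n T. t \<noteq> t' \<longrightarrow>
      {\<alpha> \<in> set (triangle_cycle t). \<alpha> \<in> C} \<inter> {\<alpha> \<in> set (triangle_cycle t'). \<alpha> \<in> C} = {}"
      using triangle_cycle_disjoint by blast
  qed
  also have "\<dots> = (\<Sum>t \<in> triangles n T. 1)"
  proof (rule sum.cong[OF refl])
    fix t assume t: "t \<in> triangles n T"
    then have "distinct (triangle_cycle t)"
      using distinct_triangle_cycle by (metis prod.exhaust)
    then have "distinct (filter (\<lambda>\<alpha>. \<alpha> \<in> C) (triangle_cycle t))"
      by simp
    from distinct_card[OF this] one t
    show "card {\<alpha> \<in> set (triangle_cycle t). \<alpha> \<in> C} = 1"
      by simp
  qed
  finally show "card C = card (triangles n T)"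
    by simp
qed

text \<open>Every arc other than the sides \<open>{a, a + 1}\<close> is the longest side \<open>{a, c}\<close> of a unique triangle.\<close>

lemma card_triangles:
  assumes "finite T"
  shows "card (triangles n T) = card T + 1"
proof -
  have root: "{0, n + 2} \<in> boundary_arcs n"
    unfolding boundary_iff gap_def by (auto simp: cyc_def)
  have "bij_betw (\<lambda>(a, b, c). {a, c}) (triangles n T) (insert {0, n + 2} T)"
    unfolding bij_betw_def
  proof
    show "inj_on (\<lambda>(a, b, c). {a, c}) (triangles n T)"
    proof (rule inj_onI)
      fix t t'
      assume t: "t \<in> triangles n T" "t' \<in> triangles n T"
        and eq: "(\<lambda>(a, b, c). {a, c}) t = (\<lambda>(a, b, c). {a, c}) t'"
      obtain a b c a' b' c' where tt: "t = (a, b, c)" "t' = (a', b', c')"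
        by (metis prod.exhaust)
      with t eq have "a = a' \<and> c = c'"
        by (auto simp: triangles_iff doubleton_eq_iff)
      with t tt tri_unique'[of a b c b'] show "t = t'"
        by (simp add: triangles_iff)
    qed
    show "(\<lambda>(a, b, c). {a, c}) ` triangles n T = insert {0, n + 2} T"
    proof (intro subset_antisym subsetI)
      fix e assume "e \<in> (\<lambda>(a, b, c). {a, c}) ` triangles n T"
      then obtain a b c where e: "e = {a, c}" and t: "tri a b c" "a < b" "b < c"
        by (auto simp: triangles_iff)
      have ac: "is_arc a c" and lt: "b < n + 3" "c < n + 3"
        using t is_arc_bounds by (auto simp: tri_def)
      show "e \<in> insert {0, n + 2} T"
        using ac
      proof (cases rule: arc_cases)
        case 3
        \<comment> \<open>As \<open>a < c\<close>, every vertex above \<open>c\<close> or below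
          \<open>a\<close> lies in this gap; testing \<open>0\<close> and \<open>n + 2\<close>
          leaves only the side \<open>{0, n + 2}\<close>.\<close>
        then have "\<not> cyc c 0 a" "\<not> cyc c (n + 2) a"
          unfolding gap_def by auto
        then have "a = 0" "c = n + 2"
          using t(2,3) lt by (auto simp: cyc_def)
        then show ?thesis using e by simp
      qed (use e t lt in \<open>auto simp: gap_def tri_def\<close>)
    next
      fix e assume e: "e \<in> insert {0, n + 2} T"
      have "\<exists>x y. e = {x, y} \<and> x < y \<and> is_arc x y \<and> \<not> gap x y"
      proof (cases "e = {0, n + 2}")
        case True
        have "\<not> gap 0 (n + 2)"
          unfolding gap_def by (auto simp: cyc_def intro!: exI[of _ 1])
        then show ?thesis
          using True root by (intro exI[of _ 0] exI[of _ "n + 2"]) (auto simp: arcs_of_def)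
      next
        case False
        then have "e \<in> T" using e by simp
        then obtain x y where "e = {x, y}" "x \<noteq> y"
          using triangulation by (auto simp: triangulation_def diagonals_def)
        then obtain x y where "e = {x, y}" "x < y"
          by (metis insert_commute nat_neq_iff)
        then show ?thesis
          using \<open>e \<in> T\<close> diagonal_not_gap T_is_arc by blast
      qed
      then obtain x y where xy: "e = {x, y}" "x < y" "is_arc x y" "\<not> gap x y"
        by blast
      \<comment> \<open>As \<open>x < y\<close>, the apex on this side lies numerically between
        \<open>x\<close> and \<open>y\<close>.\<close>
      from apex[OF this(3,4)] obtain b where "tri x b y" .
      then have "(x, b, y) \<in> triangles n T"
        using xy(2) by (auto simp: triangles_iff tri_def cyc_def)
      then show "e \<in> (\<lambda>(a, b, c). {a, c}) ` triangles n T"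
        using xy(1) by (intro image_eqI[of _ _ "(x, b, y)"]) simp_all
    qed
  qed
  then have "card (triangles n T) = card (insert {0, n + 2} T)"
    by (rule bij_betw_same_card)
  also have "\<dots> = card T + 1"
    using assms root diagonal_not_boundary by (subst card_insert_disjoint) auto
  finally show ?thesis .
qed

section \<open>The arcs around a polygon vertex\<close>

lemma shift_eq:
  "v < n + 3 \<Longrightarrow> k < n + 3 \<Longrightarrow>
    (v + k) mod (n + 3) = (if v + k < n + 3 then v + k else v + k - (n + 3))"
  by (cases "v + k < n + 3") (simp_all only: mod_less le_mod_geq not_less if_True if_False, simp_all add: le_mod_geq)

text \<open>Measuring vertices by their anticlockwise distance from \<open>v\<close> turns the
  cyclic order seen from \<open>v\<close> into a linear one.\<close>

lemma cyc_shift: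
  assumes "v < n + 3" "0 < i" "i < n + 3" "0 < j" "j < n + 3"
  shows "cyc v ((v + i) mod (n + 3)) ((v + j) mod (n + 3)) \<longleftrightarrow> i < j"
  unfolding shift_eq[OF assms(1,3)] shift_eq[OF assms(1,5)] cyc_def using assms by auto

lemma shift_surj:
  assumes "v < n + 3" "w < n + 3" "w \<noteq> v"
  obtains k where "0 < k" "k < n + 3" "w = (v + k) mod (n + 3)"
proof (cases "v < w")
  case True
  then show ?thesis
    using assms shift_eq[of v "w - v"] by (intro that[of "w - v"]) auto
next
  case False
  then show ?thesis
    using assms shift_eq[of v "w + (n + 3) - v"] by (intro that[of "w + (n + 3) - v"]) auto
qed

lemma shift_neq:
  assumes "v < n + 3" "0 < k" "k < n + 3"
  shows "(v + k) mod (n + 3) \<noteq> v" "(v + k) mod (n + 3) < n + 3"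
  using assms by (auto simp: shift_eq)

lemma arcs_around_eq:
  "arcs_around n T v = map (\<lambda>k. {v, (v + k) mod (n + 3)})
     (filter (\<lambda>k. is_arc v ((v + k) mod (n + 3))) [1..<n + 3])"
  by (simp add: arcs_around_def filter_map o_def)

lemma distinct_arcs_around:
  assumes "v < n + 3" shows "distinct (arcs_around n T v)"
proof -
  have "i = j" if "0 < i" "i < n + 3" "0 < j" "j < n + 3"
    "{v, (v + i) mod (n + 3)} = {v, (v + j) mod (n + 3)}" for i j
  proof -
    have "(v + i) mod (n + 3) = (v + j) mod (n + 3)"
      using that shift_neq assms by (auto simp: doubleton_eq_iff)
    then show ?thesis
      using cyc_shift[OF assms that(1-4)] cyc_shift[OF assms that(3,4,1,2)]
      by (metis cyc_distinct nat_neq_iff)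
  qed
  then show ?thesis
    unfolding arcs_around_eq by (auto simp: distinct_map inj_on_def)
qed

text \<open>The arcs are listed by distance from \<open>v\<close>, so neighbours in the list have no
  arc of \<open>v\<close> between them; by \<open>consecutive_tri\<close> and
  \<open>tri_consecutive\<close> these are the corners at \<open>v\<close>.\<close>

lemma set_zip_arcs_around:
  assumes v: "v < n + 3"
  shows "set (zip (arcs_around n T v) (tl (arcs_around n T v))) = {({v, y}, {v, z}) | y z. tri v y z}"
proof -
  define s where "s = (\<lambda>k. (v + k) mod (n + 3))"
  define ks where "ks = filter (\<lambda>k. is_arc v (s k)) [1..<n + 3]"
  have ks: "k \<in> set ks \<longleftrightarrow> 0 < k \<and> k < n + 3 \<and> is_arc v (s k)" for k
    by (auto simp: ks_def)
  have cyc: "cyc v (s i) (s j) \<longleftrightarrow> i < j" if "0 < i" "i < n + 3" "0 < j" "j < n + 3" for i j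
    unfolding s_def using cyc_shift[OF v that] .
  have surj: "\<exists>k \<in> set ks. w = s k" if w: "is_arc v w" for w
  proof -
    obtain k where "0 < k" "k < n + 3" "w = s k"
      using shift_surj[OF v, of w] is_arc_bounds[OF w] unfolding s_def by metis
    with w ks show ?thesis by blast
  qed
  have zip: "(i, j) \<in> set (zip ks (tl ks)) \<longleftrightarrow>
      i \<in> set ks \<and> j \<in> set ks \<and> i < j \<and> (\<forall>l \<in> set ks. i < l \<longrightarrow> \<not> l < j)" for i j
    by (rule set_zip_tl_sorted) (simp add: ks_def sorted_wrt_filter)
  have "tri v (s i) (s j)" if ij: "(i, j) \<in> set (zip ks (tl ks))" for i j
  proof (rule consecutive_tri)
    show "is_arc v (s i)" "is_arc v (s j)" "cyc v (s i) (s j)"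
      using ij ks cyc zip by auto
    fix w assume "is_arc v w" "cyc v (s i) w"
    then show "\<not> cyc v w (s j)"
      using surj[of w] ij ks cyc zip by metis
  qed
  moreover have "\<exists>(i, j) \<in> set (zip ks (tl ks)). y = s i \<and> z = s j" if t: "tri v y z" for y z
  proof -
    obtain i j where ij: "i \<in> set ks" "j \<in> set ks" "y = s i" "z = s j"
      using surj t unfolding tri_def by metis
    moreover have "\<not> l < j" if "l \<in> set ks" "i < l" for l
      using tri_consecutive[OF t, of "s l"] that ij ks cyc by metis
    moreover have "i < j"
      using t ij ks cyc unfolding tri_def by metis
    ultimately show ?thesis
      using zip by blast
  qed
  moreover have "arcs_around n T v = map (\<lambda>k. {v, s k}) ks"
    by (simp add: arcs_around_eq s_def ks_def)
  then have "zip (arcs_around n T v) (tl (arcs_around n T v)) =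
      map (\<lambda>(i, j). ({v, s i}, {v, s j})) (zip ks (tl ks))"
    by (simp add: map_tl[symmetric] zip_map_map)
  then have "set (zip (arcs_around n T v) (tl (arcs_around n T v))) =
      (\<lambda>(i, j). ({v, s i}, {v, s j})) ` set (zip ks (tl ks))"
    by simp
  ultimately show ?thesis
  proof (intro set_eqI iffI, goal_cases)
    case (1 \<alpha>)
    then obtain i j where "(i, j) \<in> set (zip ks (tl ks))" "\<alpha> = ({v, s i}, {v, s j})"
      by auto
    with 1(1) show ?case by blast
  next
    case (2 \<alpha>)
    then obtain y z where yz: "tri v y z" "\<alpha> = ({v, y}, {v, z})"
      by blast
    with 2(2) obtain i j where "(i, j) \<in> set (zip ks (tl ks))" "y = s i" "z = s j"
      by blast
    with yz 2(3) show ?case by force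
  qed
qed

text \<open>Distances \<open>1\<close> and \<open>n + 2\<close> give the two sides at
  \<open>v\<close>. At any other distance there is a vertex on either side, so no gap is possible
  and an arc there is a diagonal.\<close>

lemma arcs_around_decomp:
  assumes "v \<in> \<Union>T"
  obtains b ds b' where "arcs_around n T v = b # ds @ [b']" "b \<notin> T" "b' \<notin> T" "ds \<noteq> []" "set ds \<subseteq> T"
proof -
  obtain e where e: "e \<in> T" "v \<in> e"
    using assms by blast
  then obtain a c where "e = {a, c}"
    using triangulation by (auto simp: triangulation_def diagonals_def)
  with e obtain w where w: "{v, w} \<in> T"
    by (metis empty_iff insert_commute insert_iff)
  note vw = diagonal_bounds[OF w]
  define s where "s = (\<lambda>k. (v + k) mod (n + 3))"
  have cyc: "cyc v (s i) (s j) \<longleftrightarrow> i < j" if "0 < i" "i < n + 3" "0 < j" "j < n + 3" for i j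
    unfolding s_def using cyc_shift[OF vw(1) that] .
  have s: "s k \<noteq> v" "s k < n + 3" if "0 < k" "k < n + 3" for k
    unfolding s_def using shift_neq[OF vw(1) that] .
  have gap1: "gap v (s 1)"
    unfolding gap_def
  proof (intro allI impI notI)
    fix u assume u: "u < n + 3" "cyc v u (s 1)"
    then obtain k where "0 < k" "k < n + 3" "u = s k"
      using shift_surj[OF vw(1), of u] cyc_distinct unfolding s_def by metis
    with u cyc[of k 1] show False by simp
  qed
  have gap2: "gap (s (n + 2)) v"
    unfolding gap_def
  proof (intro allI impI notI)
    fix u assume u: "u < n + 3" "cyc (s (n + 2)) u v"
    then have "cyc v (s (n + 2)) u"
      using cyc_rotate by blast
    then obtain k where "0 < k" "k < n + 3" "u = s k"
      using shift_surj[OF vw(1), of u] cyc_distinct u unfolding s_def by metis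
    with \<open>cyc v (s (n + 2)) u\<close> cyc[of "n + 2" k] show False by simp
  qed
  have b: "{v, s 1} \<in> boundary_arcs n" "{v, s (n + 2)} \<in> boundary_arcs n"
    using gap1 gap2 s[of 1] s[of "n + 2"] vw(1) by (auto simp: boundary_iff)
  have inner: "{v, s k} \<in> T" if k: "1 < k" "k < n + 2" and a: "is_arc v (s k)" for k
    using a
  proof (cases rule: arc_cases)
    case 2
    then show ?thesis
      using cyc[of 1 k] k s[of 1] unfolding gap_def by auto
  next
    case 3
    moreover have "cyc (s k) (s (n + 2)) v"
      using cyc[of k "n + 2"] k cyc_rotate by auto
    ultimately show ?thesis
      using s[of "n + 2"] unfolding gap_def by auto
  qed
  define ds where "ds = map (\<lambda>k. {v, s k}) (filter (\<lambda>k. is_arc v (s k)) [2..<n + 2])"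
  have upt: "[1..<n + 3] = 1 # [2..<n + 2] @ [n + 2]"
  proof -
    have "[1..<n + 3] = [1..<n + 2] @ [n + 2]"
      using upt_Suc_append[of 1 "n + 2"] by (simp add: numeral_3_eq_3)
    also have "[1..<n + 2] = 1 # [2..<n + 2]"
      by (simp add: upt_conv_Cons numeral_2_eq_2)
    finally show ?thesis by simp
  qed
  have arcs: "is_arc v (s 1)" "is_arc v (s (n + 2))"
    using b by (simp_all add: arcs_of_def)
  show ?thesis
  proof
    show "arcs_around n T v = {v, s 1} # ds @ [{v, s (n + 2)}]"
      unfolding arcs_around_eq upt using arcs by (simp add: ds_def s_def)
    show "{v, s 1} \<notin> T" "{v, s (n + 2)} \<notin> T"
      using b diagonal_not_boundary by blast+
    show "set ds \<subseteq> T"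
      using inner by (auto simp: ds_def)
    obtain k where k: "0 < k" "k < n + 3" "w = s k"
      using shift_surj[OF vw(1,2)] vw(3) unfolding s_def by metis
    moreover have "k \<noteq> 1" "k \<noteq> n + 2"
      using b w k diagonal_not_boundary by blast+
    ultimately have "1 < k" "k < n + 2"
      by simp_all
    moreover have "is_arc v (s k)"
      using w T_is_arc \<open>w = s k\<close> by simp
    ultimately have "{v, s k} \<in> set ds"
      unfolding ds_def set_map by (intro imageI) (simp del: upt_Suc)
    then show "ds \<noteq> []"
      by auto
  qed
qed

lemma clockwise_follows_tri: "tri v y z \<Longrightarrow> clockwise_follows n T {v, y} {v, z}"
  unfolding clockwise_follows_iff by blast

subsection \<open>Threshold sets\<close>

text \<open>The asymmetric conditions let a frozen vertex count as lying before the threshold when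
  it is a source and behind it when it is a target.\<close>

definition threshold_set :: "arc set \<Rightarrow> arrow set" where
  "threshold_set F = {(i, j) \<in> ice_arrows n T. i \<notin> F \<and> j \<notin> T - F}"

definition successor_closed :: "arc set \<Rightarrow> bool" where
  "successor_closed F \<longleftrightarrow> F \<subseteq> T \<and> (\<forall>(i, j) \<in> Q_arrows n T. i \<in> F \<longrightarrow> j \<in> F)"

lemma threshold_set_iff:
  "(i, j) \<in> threshold_set F \<longleftrightarrow> clockwise_follows n T i j \<and> (i \<in> T \<or> j \<in> T) \<and> i \<notin> F \<and> j \<notin> T - F"
  by (auto simp: threshold_set_def ice_arrows_iff)

lemma successor_closedD:
  "successor_closed F \<Longrightarrow> clockwise_follows n T i j \<Longrightarrow> i \<in> F \<Longrightarrow> j \<in> T \<Longrightarrow> j \<in> F"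
  unfolding successor_closed_def using Q_arrows_iff by blast

text \<open>A path in \<open>Q\<close> from the target of such an arrow starts in \<open>F\<close>
  and stays there, whereas all sources lie outside \<open>F\<close>.\<close>

lemma threshold_discrete:
  assumes "successor_closed F" shows "discrete_set n T (threshold_set F)"
proof -
  have "\<not> path_in_Q n T j i'" if "(i, j) \<in> threshold_set F" "(i', j') \<in> threshold_set F" for i j i' j'
  proof
    assume "path_in_Q n T j i'"
    then have j: "j \<in> T" and "(j, i') \<in> (Q_arrows n T)\<^sup>*"
      by (auto simp: path_in_Q_def)
    have "j \<in> F"
      using j that(1) by (simp add: threshold_set_iff)
    have "i' \<in> F"
      using \<open>(j, i') \<in> (Q_arrows n T)\<^sup>*\<close> \<open>j \<in> F\<close>
      by (induction rule: rtrancl_induct) (use assms in \<open>auto simp: successor_closed_def\<close>)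
    then show False
      using that(2) by (simp add: threshold_set_iff)
  qed
  then show ?thesis
    by (auto simp: discrete_set_def threshold_set_def)
qed

lemma discrete_subset_threshold:
  assumes "discrete_set n T D"
  obtains F where "successor_closed F" "D \<subseteq> threshold_set F"
proof
  \<comment> \<open>All diagonals reachable from targets of \<open>D\<close>; discreteness says that
    no source of \<open>D\<close> is among them.\<close>
  let ?F = "{y. \<exists>\<alpha> \<in> D. path_in_Q n T (target \<alpha>) y}"
  show "successor_closed ?F"
    unfolding successor_closed_def path_in_Q_def Q_arrows_iff
    by (auto intro: rtrancl_into_rtrancl simp: Q_arrows_iff)
  show "D \<subseteq> threshold_set ?F"
  proof
    fix \<alpha> assume \<alpha>: "\<alpha> \<in> D"
    have "source \<alpha> \<notin> ?F"
      using assms \<alpha> by (auto simp: discrete_set_def)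
    moreover have "target \<alpha> \<in> T \<Longrightarrow> target \<alpha> \<in> ?F"
      using \<alpha> by (auto simp: path_in_Q_def)
    moreover have "\<alpha> \<in> ice_arrows n T"
      using assms \<alpha> by (auto simp: discrete_set_def)
    ultimately show "\<alpha> \<in> threshold_set ?F"
      by (cases \<alpha>) (simp add: threshold_set_def)
  qed
qed

end

section \<open>Acyclic quivers: threshold sets as minimal cuts and as maximal discrete sets\<close>

locale acyclic_polygon = triangulated_polygon +
  assumes acyclic: "acyclic (Q_arrows n T)" and card_T: "card T = n" and n_pos: "n \<ge> 1"
begin

lemma finite_T: "finite T"
  using card_T n_pos by (metis card.infinite not_one_le_zero)

lemma card_triangles_eq: "card (triangles n T) = n + 1"
  using card_triangles[OF finite_T] card_T by simp

text \<open>The three arrows inside such a triangle would form an oriented cycle in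
  \<open>Q\<close>.\<close>

lemma no_internal_triangle:
  assumes "tri x y z" "{x, y} \<in> T" "{y, z} \<in> T" shows "{x, z} \<notin> T"
proof
  assume xz: "{x, z} \<in> T"
  have *: "tri y z x" "tri z x y"
    using assms(1) tri_rotate by blast+
  have "({x, y}, {x, z}) \<in> Q_arrows n T" "({x, z}, {y, z}) \<in> Q_arrows n T" "({y, z}, {x, y}) \<in> Q_arrows n T"
    using clockwise_follows_tri[OF assms(1)] clockwise_follows_tri[OF *(1)]
      clockwise_follows_tri[OF *(2)] assms(2,3) xz
    by (simp_all add: Q_arrows_iff insert_commute)
  then have "({x, y}, {x, y}) \<in> (Q_arrows n T)\<^sup>+"
    by (meson trancl.simps)
  then show False
    using acyclic by (simp add: acyclic_def)
qed

text \<open>The opposite gap is impossible, as it would contain \<open>z\<close>.\<close>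

lemma tri_side:
  assumes "tri x y z" shows "{x, y} \<in> T \<or> gap x y"
proof -
  have "\<not> gap y x"
    using assms is_arc_bounds cyc_rotate unfolding tri_def gap_def by blast
  then show ?thesis
    using assms arc_cases[of x y] by (auto simp: tri_def)
qed

text \<open>If all three sides were gaps, then by \<open>cyc_cover\<close> the polygon would have no
  vertices besides \<open>x\<close>, \<open>y\<close>, \<open>z\<close>.\<close>

lemma tri_has_diagonal:
  assumes "tri x y z" shows "{x, y} \<in> T \<or> {y, z} \<in> T \<or> {x, z} \<in> T"
proof (rule ccontr)
  assume no: "\<not> ?thesis"
  have "tri y z x" "tri z x y"
    using assms tri_rotate by blast+
  then have gaps: "gap x y" "gap y z" "gap z x"
    using assms no tri_side[of x y z] tri_side[of y z x] tri_side[of z x y]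
    by (simp_all add: insert_commute)
  have "v \<in> {x, y, z}" if "v < n + 3" for v
  proof (rule ccontr)
    assume "v \<notin> {x, y, z}"
    then have "cyc x v y \<or> cyc y v z \<or> cyc z v x"
      using assms cyc_cover unfolding tri_def by simp
    with gaps that show False
      unfolding gap_def by blast
  qed
  then have "{..<n + 3} \<subseteq> {x, y, z}"
    by blast
  then have "n + 3 \<le> card {x, y, z}"
    using card_mono[of "{x, y, z}" "{..<n + 3}"] by simp
  also have "\<dots> \<le> 3"
    by (simp add: card_insert_if)
  finally show False
    using n_pos by simp
qed

text \<open>One or two sides of the triangle are diagonals, so its arrows in the ice quiver form a
  path from a frozen side through diagonals to a frozen side, which crosses the threshold
  once.\<close>

lemma threshold_triangle:
  assumes F: "successor_closed F"
  shows "\<forall>t \<in> triangles n T. length (filter (\<lambda>\<alpha>. \<alpha> \<in> threshold_set F) (triangle_cycle t)) = 1"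
  unfolding triangle_cycle_count_iff
proof (intro allI impI)
  fix x y z assume t: "tri x y z"
  have t': "tri y z x" "tri z x y"
    using t tri_rotate by blast+
  have FT: "F \<subseteq> T"
    using F by (simp add: successor_closed_def)
  note cf = clockwise_follows_tri[OF t] clockwise_follows_tri[OF t'(1)] clockwise_follows_tri[OF t'(2)]
  note closed = successor_closedD[OF F cf(1)] successor_closedD[OF F cf(2)] successor_closedD[OF F cf(3)]
  have comm: "{y, x} = {x, y}" "{z, x} = {x, z}" "{z, y} = {y, z}"
    by (simp_all add: insert_commute)
  show "of_bool (({x, y}, {x, z}) \<in> threshold_set F) + of_bool (({y, z}, {y, x}) \<in> threshold_set F) +
      of_bool (({z, x}, {z, y}) \<in> threshold_set F) = (1 :: nat)"
  proof -
    have c: "{x, y} \<in> F \<and> {x, z} \<in> T \<longrightarrow> {x, z} \<in> F" "{x, z} \<in> F \<and> {y, z} \<in> T \<longrightarrow> {y, z} \<in> F"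
      "{y, z} \<in> F \<and> {x, y} \<in> T \<longrightarrow> {x, y} \<in> F"
      using closed unfolding comm by blast+
    have d: "{x, y} \<in> F \<longrightarrow> {x, y} \<in> T" "{x, z} \<in> F \<longrightarrow> {x, z} \<in> T" "{y, z} \<in> F \<longrightarrow> {y, z} \<in> T"
      using FT by blast+
    have e: "\<not> ({x, y} \<in> T \<and> {x, z} \<in> T \<and> {y, z} \<in> T)"
      "{x, y} \<in> T \<or> {x, z} \<in> T \<or> {y, z} \<in> T"
      using no_internal_triangle[OF t] tri_has_diagonal[OF t] by blast+
    have cf': "clockwise_follows n T {x, y} {x, z} = True" "clockwise_follows n T {y, z} {x, y} = True"
      "clockwise_follows n T {x, z} {y, z} = True"
      using cf unfolding comm by blast+
    show ?thesis
      unfolding threshold_set_iff comm Diff_iff cf' simp_thms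
      by (rule exactly_one_threshold[OF c d e])
  qed
qed

text \<open>The boundary arrow is no corner. The other arrows form a path from one side at
  \<open>v\<close> through diagonals to the other side, which crosses the threshold once.\<close>

lemma threshold_big_cycle:
  assumes F: "successor_closed F" and v: "v \<in> \<Union>T"
  shows "length (filter (\<lambda>\<alpha>. \<alpha> \<in> threshold_set F) (big_cycle n T v)) = 1"
proof -
  have vn: "v < n + 3"
    using v triangulation by (auto simp: triangulation_def diagonals_def)
  have FT: "F \<subseteq> T"
    using F by (simp add: successor_closed_def)
  obtain b ds b' where xs: "arcs_around n T v = b # ds @ [b']"
    and b: "b \<notin> T" "b' \<notin> T" and ds: "ds \<noteq> []" "set ds \<subseteq> T"
    using arcs_around_decomp[OF v] .
  have zip: "zip (arcs_around n T v) (tl (arcs_around n T v)) = zip (b # ds @ [b']) (ds @ [b'])"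
    by (simp add: xs)
  have cf: "clockwise_follows n T i j" if "(i, j) \<in> set (zip (b # ds @ [b']) (ds @ [b']))" for i j
    using that set_zip_arcs_around[OF vn] clockwise_follows_tri unfolding zip by auto
  have diag: "i \<in> T \<or> j \<in> T" if "(i, j) \<in> set (zip (b # ds @ [b']) (ds @ [b']))" for i j
  proof -
    obtain d ds' where "ds = d # ds'"
      using ds(1) by (cases ds) auto
    \<comment> \<open>The second list is shorter by one, so \<open>b'\<close> is never a source:
      past the first arrow every source is a diagonal.\<close>
    moreover have "zip (d # ds' @ [b']) (ds' @ [b']) = zip (d # ds') (ds' @ [b'])"
      using zip_append[of "d # ds'" "ds' @ [b']" "[b']" "[]"] by simp
    ultimately have "i \<in> set ds \<or> j \<in> set ds"
      using that by (auto dest: set_zip_leftD)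
    with ds(2) show ?thesis by blast
  qed
  have "boundary_arrow n v \<notin> threshold_set F"
    using boundary_arrow_not_clockwise[OF vn] threshold_set_iff by (metis prod.exhaust)
  then have "length (filter (\<lambda>\<alpha>. \<alpha> \<in> threshold_set F) (big_cycle n T v)) =
      length (filter (\<lambda>\<alpha>. \<alpha> \<in> threshold_set F) (zip (b # ds @ [b']) (ds @ [b'])))"
    by (simp add: big_cycle_eq zip)
  also have "filter (\<lambda>\<alpha>. \<alpha> \<in> threshold_set F) (zip (b # ds @ [b']) (ds @ [b'])) =
      filter (\<lambda>(i, j). i \<notin> F \<and> j \<notin> T - F) (zip (b # ds @ [b']) (ds @ [b']))"
  proof (rule filter_cong[OF refl])
    fix \<alpha> assume \<alpha>: "\<alpha> \<in> set (zip (b # ds @ [b']) (ds @ [b']))"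
    obtain i j where ij: "\<alpha> = (i, j)"
      by (metis prod.exhaust)
    with cf[of i j] diag[of i j] \<alpha>
    show "\<alpha> \<in> threshold_set F \<longleftrightarrow> (case \<alpha> of (i, j) \<Rightarrow> i \<notin> F \<and> j \<notin> T - F)"
      by (simp add: threshold_set_iff)
  qed
  also have "length \<dots> = (if b \<in> F then 0 else 1)"
  proof (rule length_filter_threshold[OF ds(2) b(2)])
    fix i j assume "(i, j) \<in> set (zip (b # ds @ [b']) (ds @ [b']))" "i \<in> F" "j \<in> T"
    then show "j \<in> F"
      using successor_closedD[OF F] cf by blast
  qed
  also have "\<dots> = 1"
    using b FT by auto
  finally show ?thesis .
qed

lemma threshold_card:
  assumes "successor_closed F" shows "finite (threshold_set F)" "card (threshold_set F) = n + 1"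
proof -
  have "clockwise_follows n T i j" if "(i, j) \<in> threshold_set F" for i j
    using that by (simp add: threshold_set_iff)
  from card_transversal[OF this threshold_triangle[OF assms]] card_triangles_eq
  show "finite (threshold_set F)" "card (threshold_set F) = n + 1"
    by simp_all
qed

lemma threshold_minimal_cut:
  assumes "successor_closed F" shows "minimal_cut n T (threshold_set F)"
  unfolding minimal_cut_def cut_iff
proof (intro conjI)
  show "threshold_set F \<subseteq> tilde_arrows n T"
    by (auto simp: threshold_set_def tilde_arrows_def)
qed (use threshold_triangle[OF assms] threshold_big_cycle[OF assms] threshold_card[OF assms] in blast)+

text \<open>Every discrete set lies in a threshold set, and an inclusion between threshold sets is
  an equality because all have \<open>n + 1\<close> elements.\<close>

lemma maximal_discrete_set_iff:
  "maximal_discrete_set n T C \<longleftrightarrow> (\<exists>F. successor_closed F \<and> C = threshold_set F)"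
proof
  assume C: "maximal_discrete_set n T C"
  then obtain F where "successor_closed F" "C \<subseteq> threshold_set F"
    using discrete_subset_threshold by (auto simp: maximal_discrete_set_def)
  with C threshold_discrete show "\<exists>F. successor_closed F \<and> C = threshold_set F"
    unfolding maximal_discrete_set_def by metis
next
  assume "\<exists>F. successor_closed F \<and> C = threshold_set F"
  then obtain F where F: "successor_closed F" and C: "C = threshold_set F"
    by blast
  have "D = C" if D: "discrete_set n T D" "C \<subseteq> D" for D
  proof -
    obtain G where G: "successor_closed G" "D \<subseteq> threshold_set G"
      using discrete_subset_threshold[OF D(1)] .
    then have "C = threshold_set G"
      using card_subset_eq[of "threshold_set G" C] D(2) C threshold_card F by auto
    with G D show ?thesis by blast
  qed
  then show "maximal_discrete_set n T C"
    using threshold_discrete[OF F] C by (auto simp: maximal_discrete_set_def)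
qed

end

section \<open>Minimal cuts\<close>

text \<open>What remains of a minimal cut once \<open>minimal_cut_clockwise\<close> has excluded
  external arrows: a choice of corners.\<close>

locale transversal_cut = acyclic_polygon +
  fixes C :: "arrow set"
  assumes clockwise: "(i, j) \<in> C \<Longrightarrow> clockwise_follows n T i j"
    and triangle_cut: "\<forall>t \<in> triangles n T. length (filter (\<lambda>\<alpha>. \<alpha> \<in> C) (triangle_cycle t)) = 1"
    and vertex_cut: "v \<in> \<Union>T \<Longrightarrow> length (filter (\<lambda>\<alpha>. \<alpha> \<in> C) (big_cycle n T v)) = 1"
begin

definition chosen :: "nat \<Rightarrow> nat \<Rightarrow> nat \<Rightarrow> bool" where
  "chosen v y z \<longleftrightarrow> tri v y z \<and> ({v, y}, {v, z}) \<in> C"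

text \<open>
  At each endpoint of a diagonal there is exactly one chosen corner.  For a diagonal \<open>{p, q}\<close>,
  the polygon vertices from \<open>p\<close> anticlockwise to \<open>q\<close> span one of its two sides;
  \<open>before p q\<close> and \<open>after q p\<close> say that the chosen corners at \<open>p\<close> and \<open>q\<close>, respectively,
  lie on that side.
\<close>

definition before :: "nat \<Rightarrow> nat \<Rightarrow> bool" where
  "before v w \<longleftrightarrow> (\<exists>y z. chosen v y z \<and> (z = w \<or> cyc v z w))"

definition after :: "nat \<Rightarrow> nat \<Rightarrow> bool" where
  "after v w \<longleftrightarrow> (\<exists>y z. chosen v y z \<and> (y = w \<or> cyc v w y))"

section \<open>The position of the chosen corners relative to a diagonal\<close>

lemma chosen_tri:
  assumes "chosen x y z" shows "\<not> chosen y z x" "\<not> chosen z x y"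
proof -
  have "of_bool (({x, y}, {x, z}) \<in> C) + of_bool (({y, z}, {y, x}) \<in> C) +
      of_bool (({z, x}, {z, y}) \<in> C) = (1 :: nat)"
    using triangle_cut assms unfolding triangle_cycle_count_iff chosen_def by blast
  then show "\<not> chosen y z x" "\<not> chosen z x y"
    using assms unfolding chosen_def by (auto split: if_splits)
qed

text \<open>The boundary arrow of the big cycle at \<open>v\<close> is not in \<open>C\<close>, so
  the single cut arrow of this cycle is a corner at \<open>v\<close>.\<close>

lemma chosen_ex1:
  assumes v: "v \<in> \<Union>T"
  shows "\<exists>y z. chosen v y z" "chosen v y z \<Longrightarrow> chosen v y' z' \<Longrightarrow> y = y' \<and> z = z'"
proof -
  have vn: "v < n + 3"
    using v triangulation by (auto simp: triangulation_def diagonals_def)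
  let ?zs = "zip (arcs_around n T v) (tl (arcs_around n T v))"
  have "boundary_arrow n v \<notin> C"
    using boundary_arrow_not_clockwise[OF vn] clockwise by (metis prod.exhaust)
  then have "length (filter (\<lambda>\<alpha>. \<alpha> \<in> C) ?zs) = 1"
    using vertex_cut[OF v] by (simp add: big_cycle_eq)
  moreover have "distinct ?zs"
    using distinct_arcs_around[OF vn] by (rule distinct_zipI1)
  ultimately have ex1: "\<exists>!\<alpha>. \<alpha> \<in> set ?zs \<and> \<alpha> \<in> C"
    by (simp only: length_filter_eq_1_iff)
  have zs: "\<alpha> \<in> set ?zs \<longleftrightarrow> (\<exists>y z. \<alpha> = ({v, y}, {v, z}) \<and> tri v y z)" for \<alpha>
    unfolding set_zip_arcs_around[OF vn] by blast
  show "\<exists>y z. chosen v y z"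
    using ex1 unfolding zs chosen_def by blast
  assume ch: "chosen v y z" "chosen v y' z'"
  then have "({v, y}, {v, z}) = ({v, y'}, {v, z'})"
    using ex1 unfolding zs chosen_def by blast
  moreover have "y \<noteq> v" "z \<noteq> v" "y' \<noteq> v" "z' \<noteq> v"
    using ch cyc_distinct unfolding chosen_def tri_def by blast+
  ultimately show "y = y' \<and> z = z'"
    by (auto simp: doubleton_eq_iff)
qed

text \<open>No arc at \<open>v\<close> runs inside the chosen corner, so \<open>{v, w}\<close> lies
  at or beyond one of its two arms.\<close>

lemma before_xor_after:
  assumes vw: "{v, w} \<in> T" shows "before v w \<longleftrightarrow> \<not> after v w"
proof -
  have v: "v \<in> \<Union>T" and wv: "w \<noteq> v"
    using vw diagonal_bounds[OF vw] by auto
  obtain y z where ch: "chosen v y z"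
    using chosen_ex1(1)[OF v] by blast
  then have t: "tri v y z"
    by (simp add: chosen_def)
  have b: "before v w \<longleftrightarrow> z = w \<or> cyc v z w"
    using ch chosen_ex1(2)[OF v ch] unfolding before_def by blast
  have a: "after v w \<longleftrightarrow> y = w \<or> cyc v w y"
    using ch chosen_ex1(2)[OF v ch] unfolding after_def by blast
  have yz: "cyc v y z"
    using t by (simp add: tri_def)
  note not_between = tri_consecutive[OF t T_is_arc[OF vw]]
  show ?thesis
  proof
    assume "before v w"
    then have "cyc v y w"
      using b yz cyc_trans by blast
    then show "\<not> after v w"
      using a cyc_asym cyc_distinct by blast
  next
    assume "\<not> after v w"
    then have "cyc v y w"
      using a cyc_total[of v y w] wv cyc_distinct[OF yz] by blast
    then have "\<not> cyc v w z"
      using not_between by blast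
    then show "before v w"
      using b cyc_total[of v z w] wv cyc_distinct[OF yz] by blast
  qed
qed

text \<open>The arcs to \<open>r\<close> and \<open>q\<close> are consecutive at \<open>p\<close>: a
  corner ending no later than \<open>q\<close> is the one between them or ends no later than
  \<open>r\<close>.\<close>

lemma before_apex:
  assumes t: "tri p r q" and "before p q" shows "chosen p r q \<or> before p r"
proof (rule disjCI)
  assume nb: "\<not> before p r"
  obtain y z where ch: "chosen p y z" and z: "z = q \<or> cyc p z q"
    using assms(2) unfolding before_def by blast
  then have t': "tri p y z"
    by (simp add: chosen_def)
  then have yz: "cyc p y z" and arcs: "is_arc p y" "is_arc p z"
    by (auto simp: tri_def)
  have pr: "is_arc p r" "cyc p r q"
    using t by (auto simp: tri_def)
  have "z \<noteq> r" "\<not> cyc p z r"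
    using nb ch unfolding before_def by blast+
  then have "cyc p r z"
    using cyc_total[of p z r] cyc_distinct[OF yz] cyc_distinct[OF pr(2)] by blast
  then have "\<not> cyc p y r"
    using tri_consecutive[OF t' pr(1)] by blast
  moreover have "cyc p y q"
    using z yz cyc_trans by blast
  then have "\<not> cyc p r y"
    using tri_consecutive[OF t arcs(1)] by blast
  ultimately have "y = r"
    using cyc_total[of p y r] cyc_distinct[OF yz] cyc_distinct[OF pr(2)] by blast
  then show "chosen p r q"
    using ch t t' tri_unique by blast
qed

text \<open>Mirror image of \<open>before_apex\<close>, with the first arm of the corner in place of
  the second.\<close>

lemma after_apex:
  assumes t: "tri q p r" and "after q p" shows "chosen q p r \<or> after q r"
proof (rule disjCI)
  assume nb: "\<not> after q r"
  obtain y z where ch: "chosen q y z" and y: "y = p \<or> cyc q p y"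
    using assms(2) unfolding after_def by blast
  then have t': "tri q y z"
    by (simp add: chosen_def)
  then have yz: "cyc q y z" and arcs: "is_arc q y" "is_arc q z"
    by (auto simp: tri_def)
  have qr: "is_arc q r" "cyc q p r"
    using t by (auto simp: tri_def)
  have "y \<noteq> r" "\<not> cyc q r y"
    using nb ch unfolding after_def by blast+
  then have yr: "cyc q y r"
    using cyc_total[of q y r] cyc_distinct[OF yz] cyc_distinct[OF qr(2)] by blast
  then have "\<not> cyc q r z"
    using tri_consecutive[OF t' qr(1)] by blast
  moreover have "cyc q p z"
    using y yz cyc_trans by blast
  then have "\<not> cyc q z r"
    using tri_consecutive[OF t arcs(2)] by blast
  ultimately have "z = r"
    using cyc_total[of q z r] cyc_distinct[OF yz] cyc_distinct[OF qr(2)] by blast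
  then show "chosen q p r"
    using ch t t' tri_unique' by blast
qed

text \<open>The first arm of such a corner would end inside the gap.\<close>

lemma gap_not_before: "gap p r \<Longrightarrow> \<not> before p r"
proof
  assume gap: "gap p r" and "before p r"
  then obtain y z where "chosen p y z" and z: "z = r \<or> cyc p z r"
    unfolding before_def by blast
  then have "cyc p y z" "y < n + 3"
    using is_arc_bounds by (auto simp: chosen_def tri_def)
  moreover from this have "cyc p y r"
    using z cyc_trans by blast
  ultimately show False
    using gap unfolding gap_def by blast
qed

lemma gap_not_after: "gap r q \<Longrightarrow> \<not> after q r"
proof
  assume gap: "gap r q" and "after q r"
  then obtain y z where "chosen q y z" and y: "y = r \<or> cyc q r y"
    unfolding after_def by blast
  then have "cyc q y z" "z < n + 3"
    using is_arc_bounds by (auto simp: chosen_def tri_def)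
  moreover from this have "cyc q r z"
    using y cyc_trans by blast
  then have "cyc r z q"
    using cyc_rotate by blast
  ultimately show False
    using gap unfolding gap_def by blast
qed

text \<open>
  The induction is on the number of vertices strictly between \<open>p\<close> and \<open>q\<close>: as the triangle below
  \<open>{p, q}\<close> is not internal, only one of its other two sides can have a triangle below it.
\<close>

lemma not_before_and_after:
  assumes "{p, q} \<in> T" shows "\<not> (before p q \<and> after q p)"
  using assms
proof (induction "card {v. v < n + 3 \<and> cyc p v q}" arbitrary: p q rule: less_induct)
  case less
  obtain r where t: "tri p r q"
    using apex[OF T_is_arc] less.prems diagonal_not_gap by blast
  then have t1: "tri r q p" and t2: "tri q p r"
    using tri_rotate by blast+
  have r: "r < n + 3" "cyc p r q"
    using t is_arc_bounds by (auto simp: tri_def)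
  show ?case
  proof
    assume "before p q \<and> after q p"
    then have bef: "chosen p r q \<or> before p r" and aft: "chosen q p r \<or> after q r"
      using before_apex[OF t] after_apex[OF t2] by blast+
    have "{p, r} \<notin> T \<or> {r, q} \<notin> T"
      using no_internal_triangle[OF t] less.prems by blast
    then consider "gap p r" | "gap r q"
      using tri_side[OF t] tri_side[OF t1] by blast
    then show False
    proof cases
      case 1
      \<comment> \<open>No corner at \<open>p\<close> fits below the side \<open>{p, r}\<close>, so
        the triangle is cut at \<open>p\<close>, hence neither at \<open>q\<close> nor at
        \<open>r\<close>.\<close>
      then have ch: "chosen p r q"
        using bef gap_not_before by blast
      then have no: "\<not> chosen q p r" "\<not> chosen r q p"
        using chosen_tri by blast+
      with aft have aq: "after q r"
        by blast
      then have rq: "{r, q} \<in> T"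
        using tri_side[OF t1] gap_not_after by blast
      have "\<not> (before r q \<and> after q r)"
      proof (rule less.hyps[OF _ rq], rule psubset_card_mono)
        have "cyc p v q" if "cyc r v q" for v
          using that r(2) by (auto simp: cyc_def)
        moreover have "\<not> cyc r r q"
          by (simp add: cyc_def)
        ultimately show "{v. v < n + 3 \<and> cyc r v q} \<subset> {v. v < n + 3 \<and> cyc p v q}"
          using r by blast
      qed simp
      \<comment> \<open>The corner at \<open>r\<close> is pushed to the side of
        \<open>{r, q}\<close> that contains \<open>p\<close>. As \<open>{p, r}\<close> is a side,
        only the corner of the present triangle is left there, and it is not chosen.\<close>
      then have "after r q"
        using aq before_xor_after[OF rq] by blast
      then show False
        using after_apex[OF t1] no(2) gap_not_after 1 by blast
    next
      case 2
      \<comment> \<open>Mirror image of the first case: \<open>{r, q}\<close> is a side and the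
        triangle is cut at \<open>q\<close>.\<close>
      then have ch: "chosen q p r"
        using aft gap_not_after by blast
      then have no: "\<not> chosen p r q" "\<not> chosen r q p"
        using chosen_tri by blast+
      with bef have bp: "before p r"
        by blast
      then have pr: "{p, r} \<in> T"
        using tri_side[OF t] gap_not_before by blast
      have "\<not> (before p r \<and> after r p)"
      proof (rule less.hyps[OF _ pr], rule psubset_card_mono)
        have "cyc p v q" if "cyc p v r" for v
          using that r(2) by (auto simp: cyc_def)
        moreover have "\<not> cyc p r r"
          by (simp add: cyc_def)
        ultimately show "{v. v < n + 3 \<and> cyc p v r} \<subset> {v. v < n + 3 \<and> cyc p v q}"
          using r by blast
      qed simp
      moreover have "{r, p} \<in> T"
        using pr by (simp add: insert_commute)
      ultimately have "before r p"
        using bp before_xor_after by blast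
      then show False
        using before_apex[OF t1] no(2) gap_not_before 2 by blast
    qed
  qed
qed

text \<open>The corners at \<open>p\<close> and \<open>q\<close> lie on different sides of the
  diagonal, so being early does not depend on the end at which it is tested.\<close>

lemma before_commute:
  assumes "{p, q} \<in> T" shows "before p q \<longleftrightarrow> before q p"
proof -
  have "{q, p} \<in> T"
    using assms by (simp add: insert_commute)
  then show ?thesis
    using assms not_before_and_after before_xor_after by blast
qed

text \<open>Otherwise \<open>{y, z}\<close> cuts off the triangle at \<open>v\<close>. That triangle
  is cut at \<open>v\<close>, so the corners at \<open>y\<close> and \<open>z\<close> both lie on
  the other side of \<open>{y, z}\<close>, against \<open>before_commute\<close>.\<close>

lemma chosen_ice:
  assumes ch: "chosen v y z" shows "{v, y} \<in> T \<or> {v, z} \<in> T"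
proof (rule ccontr)
  assume no: "\<not> ?thesis"
  have t: "tri v y z" "tri y z v" "tri z v y"
    using ch tri_rotate unfolding chosen_def by blast+
  have zv: "{z, v} \<notin> T"
    using no by (simp add: insert_commute)
  have gaps: "gap v y" "gap z v"
    using tri_side[OF t(1)] tri_side[OF t(3)] no zv by blast+
  have yz: "{y, z} \<in> T"
    using tri_has_diagonal[OF t(1)] no by blast
  have "\<not> before z y"
    using before_apex[OF t(3)] chosen_tri[OF ch] gap_not_before gaps by blast
  moreover have "\<not> after y z"
    using after_apex[OF t(2)] chosen_tri[OF ch] gap_not_after gaps by blast
  ultimately show False
    using before_commute[OF yz] before_xor_after[OF yz] by blast
qed

definition early_diagonals :: "arc set" where
  "early_diagonals = {{p, q} | p q. {p, q} \<in> T \<and> before p q}"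

lemma early_diagonals_iff: "{p, q} \<in> early_diagonals \<longleftrightarrow> {p, q} \<in> T \<and> before p q"
  using before_commute unfolding early_diagonals_def
  by (auto simp: doubleton_eq_iff insert_commute)

lemma successor_closed_early: "successor_closed early_diagonals"
proof -
  have "j \<in> early_diagonals" if ij: "(i, j) \<in> Q_arrows n T" "i \<in> early_diagonals" for i j
  proof -
    obtain v y z where t: "tri v y z" and eq: "i = {v, y}" "j = {v, z}"
      using ij(1) by (auto simp: Q_arrows_iff clockwise_follows_iff)
    have "before v y"
      using ij(2) eq by (simp add: early_diagonals_iff)
    \<comment> \<open>The arrow leads to an arc further anticlockwise at \<open>v\<close>, so a
      corner preceding its source also precedes its target.\<close>
    then have "before v z"
      using t cyc_trans unfolding before_def tri_def by blast
    then show ?thesis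
      using ij(1) eq by (simp add: early_diagonals_iff Q_arrows_iff)
  qed
  moreover have "early_diagonals \<subseteq> T"
    by (auto simp: early_diagonals_def)
  ultimately show ?thesis
    by (auto simp: successor_closed_def)
qed

text \<open>A chosen corner precedes its own target and follows its own source; a diagonal source is
  therefore not early, while a diagonal target is.\<close>

lemma subset_threshold_early: "C \<subseteq> threshold_set early_diagonals"
proof
  fix \<alpha> assume \<alpha>: "\<alpha> \<in> C"
  then have "clockwise_follows n T (source \<alpha>) (target \<alpha>)"
    using clockwise by simp
  then obtain v y z where t: "tri v y z" and eq: "\<alpha> = ({v, y}, {v, z})"
    unfolding clockwise_follows_iff by (metis prod.collapse)
  then have ch: "chosen v y z"
    using \<alpha> by (simp add: chosen_def)
  have "before v z" "after v y"
    using ch unfolding before_def after_def by blast+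
  then have "{v, y} \<notin> early_diagonals" "{v, z} \<in> T \<Longrightarrow> {v, z} \<in> early_diagonals"
    using before_xor_after by (auto simp: early_diagonals_iff)
  then show "\<alpha> \<in> threshold_set early_diagonals"
    using chosen_ice[OF ch] clockwise_follows_tri[OF t] unfolding eq threshold_set_iff by blast
qed

end

section \<open>Identification of the minimal cuts\<close>

context acyclic_polygon
begin

text \<open>The corners in \<open>C\<close> already number \<open>n + 1\<close>, one for each
  triangle, which leaves no room for an external arrow.\<close>

lemma minimal_cut_clockwise:
  assumes "minimal_cut n T C" "(i, j) \<in> C" shows "clockwise_follows n T i j"
proof -
  define C0 where "C0 = {\<alpha> \<in> C. clockwise_follows n T (source \<alpha>) (target \<alpha>)}"
  have cf: "clockwise_follows n T i j" if "(i, j) \<in> C0" for i j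
    using that by (simp add: C0_def)
  have "length (filter (\<lambda>\<alpha>. \<alpha> \<in> C0) (triangle_cycle t)) = 1" if t: "t \<in> triangles n T" for t
  proof -
    have "filter (\<lambda>\<alpha>. \<alpha> \<in> C0) (triangle_cycle t) = filter (\<lambda>\<alpha>. \<alpha> \<in> C) (triangle_cycle t)"
    proof (rule filter_cong[OF refl])
      fix \<alpha> assume "\<alpha> \<in> set (triangle_cycle t)"
      then have "clockwise_follows n T (source \<alpha>) (target \<alpha>)"
        using t unfolding clockwise_follows_def by auto
      then show "\<alpha> \<in> C0 \<longleftrightarrow> \<alpha> \<in> C"
        by (simp add: C0_def)
    qed
    with t assms(1) show ?thesis
      by (simp add: minimal_cut_def cut_iff)
  qed
  then have "card C0 = n + 1"
    using card_transversal(1)[OF cf] card_triangles_eq by simp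
  moreover have "card C = n + 1"
    using assms(1) by (simp add: minimal_cut_def)
  moreover from this have "finite C"
    by (intro card_ge_0_finite) simp
  ultimately have "C0 = C"
    by (intro card_subset_eq) (auto simp: C0_def)
  with cf assms(2) show ?thesis by blast
qed

lemma minimal_cut_iff:
  "minimal_cut n T C \<longleftrightarrow> (\<exists>F. successor_closed F \<and> C = threshold_set F)"
proof
  assume C: "minimal_cut n T C"
  interpret transversal_cut n T C
    by unfold_locales (use C minimal_cut_clockwise in \<open>auto simp: minimal_cut_def cut_iff\<close>)
  have "card C = n + 1"
    using C by (simp add: minimal_cut_def)
  \<comment> \<open>Inclusion together with equal finite size gives equality.\<close>
  then have "C = threshold_set early_diagonals"
    using card_subset_eq subset_threshold_early threshold_card[OF successor_closed_early] by metis
  then show "\<exists>F. successor_closed F \<and> C = threshold_set F"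
    using successor_closed_early by blast
qed (use threshold_minimal_cut in blast)

end

theorem theorem4p6:
  fixes n :: nat and T :: "arc set" and d :: "nat \<Rightarrow> arc"
  assumes "n \<ge> 1"
    and "triangulation n T"
    and "bij_betw d {1..n} T"
    and "acyclic (Q_arrows n T)"
    and "\<And>i j. i \<in> {1..n} \<Longrightarrow> j \<in> {1..n} \<Longrightarrow>
           ((d i, d j) \<in> Q_arrows n T \<or> (d j, d i) \<in> Q_arrows n T) \<longleftrightarrow> (j = i + 1 \<or> i = j + 1)"
  shows "\<forall>C \<subseteq> tilde_arrows n T.
           minimal_cut n T C \<longleftrightarrow> C \<subseteq> ice_arrows n T \<and> maximal_discrete_set n T C"
proof -
  have "card T = n"
    using bij_betw_same_card[OF assms(3)] by simp
  with assms interpret acyclic_polygon n T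
    by unfold_locales
  show ?thesis
    \<comment> \<open>Both notions describe the threshold sets, which consist of arrows of the ice
      quiver by construction.\<close>
    unfolding minimal_cut_iff maximal_discrete_set_iff
    by (auto simp: threshold_set_def)
qed

end
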